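(* Let $(X,T)$ be a topological dynamical system. If $h_{pol}(T,X)<\infty$, then $$h_{pol}(T,X)=\max_{\mu\in\mathcal{M}(X,T)}h^{pol}_\mu(T).$$
   Context: A topological dynamical system $(X,T)$ is a continuous self-map $T:X\to X$ of a compact metric space $(X,d)$. $\mathcal{M}(X,T)$ is the set of $T$-invariant Borel probability measures on $X$, and $C(X)$ is the space of real-valued continuous functions on $X$. For $n\ge1$ put $d_n(x,y)=\max_{0\le j\le n-1}d(T^jx,T^jy)$. A set $E\subset X$ is $(d_n,\epsilon)$-separated if $d_n(x,y)>\epsilon$ for all distinct $x,y\in E$. For $f\in C(X)$ put $S_nf(x)=\sum_{j=0}^{\lceil\log n\rceil}f(T^jx)$, where $\lceil u\rceil$ is the smallest integer greater than $u$. The polynomial topological pressure of $f$ is $$P_{pol}(T,f)=\lim_{\epsilon\to0}\limsup_{n\to\infty}\frac1{\log n}\log\sup_{E}\Big\{\sum_{x\in E}e^{S_nf(x)}\Big\},$$ the supremum being over all $(d_n,\epsilon)$-separated sets $E\subset X$. The polynomial topological entropy is $h_{pol}(T,X)=P_{pol}(T,0)$. For $\mu\in\mathcal{M}(X,T)$, the polynomial measure-theoretic entropy is $$h^{pol}_\mu(T)=\inf_{f\in C(X)}\Big\{P_{pol}(T,f)-\int f\,d\mu\Big\}.$$ *)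

theory Defs
  imports "HOL-Probability.Probability"
begin

definition bowen_dist :: "('a::metric_space \<Rightarrow> 'a) \<Rightarrow> nat \<Rightarrow> 'a \<Rightarrow> 'a \<Rightarrow> real" where
  "bowen_dist T n x y = Max ((\<lambda>j. dist ((T ^^ j) x) ((T ^^ j) y)) ` {..<n})"

definition bowen_separated :: "('a::metric_space \<Rightarrow> 'a) \<Rightarrow> nat \<Rightarrow> real \<Rightarrow> 'a set \<Rightarrow> bool" where
  "bowen_separated T n \<epsilon> E \<longleftrightarrow> (\<forall>x\<in>E. \<forall>y\<in>E. x \<noteq> y \<longrightarrow> bowen_dist T n x y > \<epsilon>)"

text \<open>
  The last index of the following sum is the smallest integer strictly greater than
  \<open>ln n\<close>, i.e. \<open>\<lfloor>ln n\<rfloor> + 1\<close>, which differs from \<open>\<lceil>ln n\<rceil>\<close> only if \<open>ln n\<close> is an integer.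
\<close>

definition log_birkhoff_sum :: "('a \<Rightarrow> 'a) \<Rightarrow> ('a \<Rightarrow> real) \<Rightarrow> nat \<Rightarrow> 'a \<Rightarrow> real" where
  "log_birkhoff_sum T f n x = (\<Sum>j = 0..nat (\<lfloor>ln (real n)\<rfloor> + 1). f ((T ^^ j) x))"

text \<open>
  The supremum below is a supremum of real numbers. It is the intended one in the situation
  of interest: if the space is compact, \<open>T\<close> and \<open>f\<close> are continuous, \<open>n \<ge> 1\<close> and \<open>\<epsilon> > 0\<close>, then
  all separated sets are finite and the sums are bounded; see \<open>bowen_separated_finite_card\<close> and
  \<open>bdd_above_separated_sums\<close>.
\<close>

definition separated_sum_sup ::
    "('a::metric_space \<Rightarrow> 'a) \<Rightarrow> ('a \<Rightarrow> real) \<Rightarrow> nat \<Rightarrow> real \<Rightarrow> real" where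
  "separated_sum_sup T f n \<epsilon> =
     (SUP E\<in>{E. bowen_separated T n \<epsilon> E}. \<Sum>x\<in>E. exp (log_birkhoff_sum T f n x))"

definition pol_pressure_at ::
    "('a::metric_space \<Rightarrow> 'a) \<Rightarrow> ('a \<Rightarrow> real) \<Rightarrow> real \<Rightarrow> ereal" where
  "pol_pressure_at T f \<epsilon> =
     limsup (\<lambda>n. ereal (1 / ln (real n) * ln (separated_sum_sup T f n \<epsilon>)))"

text \<open>The limit exists in the situation of interest, see \<open>pol_pressure_tendsto\<close>.\<close>

definition pol_pressure :: "('a::metric_space \<Rightarrow> 'a) \<Rightarrow> ('a \<Rightarrow> real) \<Rightarrow> ereal" where
  "pol_pressure T f = Lim (at_right 0) (pol_pressure_at T f)"

definition pol_top_entropy :: "('a::metric_space \<Rightarrow> 'a) \<Rightarrow> ereal" where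
  "pol_top_entropy T = pol_pressure T (\<lambda>_. 0)"

definition invariant_measures :: "('a::metric_space \<Rightarrow> 'a) \<Rightarrow> 'a measure set" where
  "invariant_measures T = {\<mu>. sets \<mu> = sets borel \<and> prob_space \<mu> \<and> distr \<mu> borel T = \<mu>}"

definition pol_measure_entropy :: "('a::metric_space \<Rightarrow> 'a) \<Rightarrow> 'a measure \<Rightarrow> ereal" where
  "pol_measure_entropy T \<mu> =
     (INF f\<in>{f::'a \<Rightarrow> real. continuous_on UNIV f}. pol_pressure T f - ereal (\<integral>x. f x \<partial>\<mu>))"

lemma continuous_on_funpow:
  fixes T :: "'a::topological_space \<Rightarrow> 'a"
  assumes "continuous_on UNIV T"
  shows "continuous_on UNIV (T ^^ j)"
proof (induction j)
  case (Suc j)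
  then show ?case
    using continuous_on_compose[OF Suc] assms continuous_on_subset by (simp, blast)
qed (simp add: id_def)

lemma bowen_separated_finite_card:
  fixes T :: "'a::metric_space \<Rightarrow> 'a"
  assumes X: "compact (UNIV :: 'a set)" and T: "continuous_on UNIV T" and n: "n \<ge> 1" and e: "\<epsilon> > 0"
  shows "\<exists>N. \<forall>E. bowen_separated T n \<epsilon> E \<longrightarrow> finite E \<and> card E \<le> N"
proof -
  have "\<exists>d>0. \<forall>x y. dist x y < d \<longrightarrow> dist ((T ^^ j) x) ((T ^^ j) y) < \<epsilon>" for j
    using compact_uniformly_continuous[OF continuous_on_funpow[OF T] X, of j] e
    unfolding uniformly_continuous_on_def by (metis UNIV_I dist_commute)
  then obtain d where d: "\<And>j. d j > 0"
      "\<And>j x y. dist x y < d j \<Longrightarrow> dist ((T ^^ j) x) ((T ^^ j) y) < \<epsilon>"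
    by metis
  define r where "r = Min (d ` {..<n})"
  have ne: "{..<n} \<noteq> {}" using n by (simp add: lessThan_empty_iff)
  have r: "r > 0" "\<And>j. j < n \<Longrightarrow> r \<le> d j"
    using d(1) ne by (auto simp: r_def Min_gr_iff)
  have close: "bowen_dist T n x y < \<epsilon>" if "dist x y < r" for x y
  proof -
    have "dist ((T ^^ j) x) ((T ^^ j) y) < \<epsilon>" if "j < n" for j
      using d(2)[of x y j] r(2)[OF that] \<open>dist x y < r\<close> by linarith
    then show ?thesis unfolding bowen_dist_def using ne by (subst Max_less_iff) auto
  qed
  obtain K :: "'a set" where K: "finite K" "UNIV \<subseteq> (\<Union>x\<in>K. ball x (r/2))"
    using seq_compact_imp_totally_bounded[OF X[unfolded compact_eq_seq_compact_metric]] r(1)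
    by (metis half_gt_zero)
  then have "\<forall>x. \<exists>k\<in>K. dist k x < r/2" by (auto simp: subset_iff)
  then obtain c where c: "\<And>x. c x \<in> K" "\<And>x. dist (c x) x < r/2" by metis
  show ?thesis
  proof (intro exI allI impI)
    fix E assume E: "bowen_separated T n \<epsilon> E"
    have "inj_on c E"
    proof (rule inj_onI, rule ccontr)
      fix x y assume xy: "x \<in> E" "y \<in> E" "c x = c y" "x \<noteq> y"
      have "dist x y < r"
        using c(2)[of x] c(2)[of y] xy(3) dist_triangle3[of x y "c x"] by simp
      then show False using close[of x y] E xy unfolding bowen_separated_def by force
    qed
    then show "finite E \<and> card E \<le> card K"
      using K(1) c(1) by (metis card_inj_on_le finite_imageD finite_subset image_subsetI)
  qed
qed

lemma bdd_above_separated_sums: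
  fixes T :: "'a::metric_space \<Rightarrow> 'a" and f :: "'a \<Rightarrow> real"
  assumes X: "compact (UNIV :: 'a set)" and T: "continuous_on UNIV T"
    and f: "continuous_on UNIV f" and n: "n \<ge> 1" and e: "\<epsilon> > 0"
  shows "bdd_above ((\<lambda>E. \<Sum>x\<in>E. exp (log_birkhoff_sum T f n x)) ` {E. bowen_separated T n \<epsilon> E})"
proof -
  obtain N where N: "\<And>E. bowen_separated T n \<epsilon> E \<Longrightarrow> finite E \<and> card E \<le> N"
    using bowen_separated_finite_card[OF X T n e] by blast
  have "continuous_on UNIV (\<lambda>x. exp (log_birkhoff_sum T f n x))"
    unfolding log_birkhoff_sum_def
    by (intro continuous_intros continuous_on_compose2[OF f continuous_on_funpow[OF T]]) auto
  then have "bdd_above (range (\<lambda>x. exp (log_birkhoff_sum T f n x)))"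
    by (intro bounded_imp_bdd_above compact_imp_bounded compact_continuous_image X)
  then obtain B where B: "\<And>x. exp (log_birkhoff_sum T f n x) \<le> B"
    by (auto simp: bdd_above_def)
  have B0: "0 \<le> B" using B[of undefined] exp_ge_zero order_trans by blast
  show ?thesis
  proof (rule bdd_aboveI2)
    fix E assume "E \<in> {E. bowen_separated T n \<epsilon> E}"
    then have E: "finite E" "card E \<le> N" using N by auto
    have "(\<Sum>x\<in>E. exp (log_birkhoff_sum T f n x)) \<le> of_nat (card E) * B"
      using B by (intro sum_bounded_above) auto
    also have "\<dots> \<le> of_nat N * B" using E B0 by (intro mult_right_mono) auto
    finally show "(\<Sum>x\<in>E. exp (log_birkhoff_sum T f n x)) \<le> of_nat N * B" .
  qed
qed

lemma pol_pressure_tendsto: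
  fixes T :: "'a::metric_space \<Rightarrow> 'a" and f :: "'a \<Rightarrow> real"
  assumes X: "compact (UNIV :: 'a set)" and T: "continuous_on UNIV T"
    and f: "continuous_on UNIV f"
  shows "(pol_pressure_at T f \<longlongrightarrow> pol_pressure T f) (at_right 0)"
proof -
  have anti: "pol_pressure_at T f b \<le> pol_pressure_at T f a" if ab: "0 < a" "a \<le> b" for a b
    unfolding pol_pressure_at_def
  proof (rule Limsup_mono, rule eventually_sequentiallyI[of 2])
    fix n :: nat assume n: "2 \<le> n"
    let ?S = "\<lambda>E. \<Sum>x\<in>E. exp (log_birkhoff_sum T f n x)"
    have bdd: "bdd_above (?S ` {E. bowen_separated T n \<epsilon> E})" if "\<epsilon> > 0" for \<epsilon>
      using bdd_above_separated_sums[OF X T f _ that] n by simp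
    have le: "separated_sum_sup T f n b \<le> separated_sum_sup T f n a"
      unfolding separated_sum_sup_def
    proof (rule cSUP_subset_mono[OF _ bdd])
      show "{E. bowen_separated T n b E} \<noteq> {}"
        by (auto simp: bowen_separated_def intro: exI[of _ "{}"])
      show "{E. bowen_separated T n b E} \<subseteq> {E. bowen_separated T n a E}"
        using ab by (fastforce simp: bowen_separated_def)
    qed (use ab in auto)
    have "0 < ?S {undefined}" by simp
    also have "?S {undefined} \<le> separated_sum_sup T f n b"
      unfolding separated_sum_sup_def
      using ab by (intro cSUP_upper bdd) (auto simp: bowen_separated_def)
    finally have pos: "0 < separated_sum_sup T f n b" .
    show "ereal (1 / ln (real n) * ln (separated_sum_sup T f n b))
        \<le> ereal (1 / ln (real n) * ln (separated_sum_sup T f n a))"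
      using pos le n by (simp add: divide_right_mono)
  qed
  have "(pol_pressure_at T f \<longlongrightarrow> (SUP e\<in>{0<..}. pol_pressure_at T f e)) (at_right 0)"
  proof (rule order_tendstoI)
    fix l assume "l < (SUP e\<in>{0<..}. pol_pressure_at T f e)"
    then obtain e where e: "e > 0" "l < pol_pressure_at T f e"
      by (auto simp: less_SUP_iff)
    have "l < pol_pressure_at T f x" if "0 < x" "x < e" for x
      using e(2) anti[of x e] that by (auto intro: less_le_trans)
    then show "eventually (\<lambda>x. l < pol_pressure_at T f x) (at_right 0)"
      using e(1) by (auto simp: eventually_at_right_field)
  next
    fix u assume u: "(SUP e\<in>{0<..}. pol_pressure_at T f e) < u"
    have "pol_pressure_at T f x < u" if "0 < x" for x
      using u SUP_upper[of x "{0<..}" "pol_pressure_at T f"] that by (auto intro: le_less_trans)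
    then show "eventually (\<lambda>x. pol_pressure_at T f x < u) (at_right 0)"
      by (auto simp: eventually_at_right_field intro!: exI[of _ 1])
  qed
  then show ?thesis
    unfolding pol_pressure_def using tendsto_Lim trivial_limit_at_right_real by metis
qed

end

theory Submission
  imports Defs "HOL-Real_Asymp.Real_Asymp"
begin

text \<open>
  The pressure \<open>P\<close> is a finite convex functional on continuous functions with \<open>P f \<le> P g + c\<close>
  whenever \<open>f \<le> g + c\<close>, because \<open>S\<^sub>n\<close> has about \<open>ln n\<close> summands. So every subgradient of \<open>P\<close> at
  \<open>0\<close> is integration against a probability measure \<open>\<mu>\<close>. It is invariant since the Birkhoff sums
  of \<open>f \<circ> T - f\<close> telescope and hence \<open>P (\<plusminus>(f \<circ> T - f)) \<le> P 0\<close>. The subgradient inequality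
  \<open>P 0 \<le> P f - \<integral>f d\<mu>\<close> says that \<open>\<mu>\<close> attains the maximum.

  For the existence of \<open>\<mu>\<close>, Hahn-Banach is applied on all bounded functions rather than on
  \<open>C(X)\<close>: the functional then has values on indicator functions, so its image under a map
  \<open>h: X \<rightarrow> [0,1]\<close>, not necessarily measurable, is a limit of discrete distributions and Helly's
  theorem produces a measure on the line. Choosing \<open>h\<close> injective with uniformly continuous inverse
  transports this measure back to \<open>X\<close>.
\<close>

subsection \<open>Linear minorants of sublinear functionals\<close>

text \<open>Zorn's lemma for the reversed pointwise order: the pointwise infimum of a nonempty chain
  is again sublinear, because of any two members of the chain one lies below the other.\<close>

lemma sublinear_minimal_exists:
  fixes p :: "'v::real_vector \<Rightarrow> real"
  defines "S \<equiv> {q. (\<forall>x y. q (x + y) \<le> q x + q y) \<and> (\<forall>c x. c > 0 \<longrightarrow> q (c *\<^sub>R x) = c * q x) \<and> q \<le> p}"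
  assumes p: "p \<in> S"
  shows "\<exists>m\<in>S. \<forall>q\<in>S. q \<le> m \<longrightarrow> q = m"
proof (rule predicate_Zorn)
  show "partial_order_on S (relation_of (\<lambda>q r. r \<le> q) S)"
    by (intro partial_order_on_relation_ofI) auto
next
  fix C assume C: "C \<in> Chains (relation_of (\<lambda>q r. r \<le> q) S)"
  have CS: "q \<in> S" if "q \<in> C" for q
    using C that by (auto simp: Chains_def relation_of_def)
  have total: "q \<le> r \<or> r \<le> q" if "q \<in> C" "r \<in> C" for q r
    using C that by (auto simp: Chains_def relation_of_def)
  show "\<exists>u\<in>S. \<forall>a\<in>C. u \<le> a"
  proof (cases "C = {}")
    case True
    then show ?thesis using p by auto
  next
    case False
    define u where "u x = (INF q\<in>C. q x)" for x
    \<comment> \<open>From \<open>q 0 = 0\<close> follows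
      \<open>0 \<le> q x + q (- x) \<le> q x + p (- x)\<close>. This bound does not depend on
      \<open>q\<close>, so the infimum over the chain is a real number.\<close>
    have low: "- p (- x) \<le> q x" if "q \<in> C" for q x
    proof -
      have add: "\<And>x y. q (x + y) \<le> q x + q y"
        and hom: "\<And>c x. c > 0 \<Longrightarrow> q (c *\<^sub>R x) = c * q x" and le: "\<And>x. q x \<le> p x"
        using CS[OF that] by (auto simp: S_def le_fun_def)
      have "q 0 = 0" using hom[of 2 0] by simp
      then show ?thesis using add[of x "- x"] le[of "- x"] by simp
    qed
    have bdd: "bdd_below ((\<lambda>q. q x) ` C)" for x
      using low by (auto simp: bdd_below_def)
    have u_le: "u x \<le> q x" if "q \<in> C" for q x
      unfolding u_def by (rule cINF_lower[OF bdd that])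
    have "u (x + y) \<le> u x + u y" for x y
    proof -
      \<comment> \<open>The two arguments may use different members of the chain; the smaller member
        serves both. Afterwards the infima over \<open>q\<close> and \<open>r\<close> are taken one
        at a time.\<close>
      have *: "u (x + y) \<le> q x + r y" if qr: "q \<in> C" "r \<in> C" for q r
      proof -
        obtain s where s: "s \<in> C" "s \<le> q" "s \<le> r" using total[OF qr] qr by auto
        have "u (x + y) \<le> s (x + y)" by (rule u_le[OF s(1)])
        also have "\<dots> \<le> s x + s y" using CS[OF s(1)] by (auto simp: S_def)
        also have "\<dots> \<le> q x + r y" using s(2,3) by (intro add_mono) (auto simp: le_fun_def)
        finally show ?thesis .
      qed
      have "u (x + y) - r y \<le> u x" if "r \<in> C" for r
        unfolding u_def[of x] using *[OF _ that] False
        by (intro cINF_greatest) (auto simp: algebra_simps)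
      then have "u (x + y) - u x \<le> u y"
        unfolding u_def[of y] using False
        by (intro cINF_greatest) (auto simp: algebra_simps)
      then show ?thesis by simp
    qed
    moreover have "u (c *\<^sub>R x) = c * u x" if "c > 0" for c x
    proof (rule antisym)
      have scale: "q (c *\<^sub>R x) = c * q x" if "q \<in> C" for q
        using CS[OF that] \<open>c > 0\<close> by (auto simp: S_def)
      have "u (c *\<^sub>R x) / c \<le> u x"
        unfolding u_def[of x] using False u_le[of _ "c *\<^sub>R x"] scale that
        by (intro cINF_greatest) (auto simp: field_simps)
      then show "u (c *\<^sub>R x) \<le> c * u x" using that by (simp add: field_simps)
      show "c * u x \<le> u (c *\<^sub>R x)"
        unfolding u_def[of "c *\<^sub>R x"] using False that
        by (intro cINF_greatest) (simp_all add: scale u_le)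
    qed
    moreover have "u \<le> p"
    proof -
      obtain q where "q \<in> C" using False by auto
      then show ?thesis
        using u_le[of q] CS[of q] by (auto simp: S_def le_fun_def intro: order_trans[OF u_le])
    qed
    ultimately have "u \<in> S" by (auto simp: S_def)
    then show ?thesis using u_le by (auto simp: le_fun_def)
  qed
qed

text \<open>A minimal sublinear functional is linear, since \<open>\<lambda>x. INF t\<ge>0. q (x + t y) - t q y\<close> is a
  sublinear minorant of \<open>q\<close>.\<close>

theorem sublinear_dominates_linear:
  fixes p :: "'v::real_vector \<Rightarrow> real"
  assumes add: "\<And>x y. p (x + y) \<le> p x + p y"
    and hom: "\<And>c x. c > 0 \<Longrightarrow> p (c *\<^sub>R x) = c * p x"
  shows "\<exists>L. linear L \<and> (\<forall>x. L x \<le> p x)"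
proof -
  obtain q where add_q: "\<And>x y. q (x + y) \<le> q x + q y"
    and hom_q: "\<And>c x. c > 0 \<Longrightarrow> q (c *\<^sub>R x) = c * q x" and qp: "q \<le> p"
    and minimal: "\<And>r. \<lbrakk>\<And>x y. r (x + y) \<le> r x + r y; \<And>c x. c > 0 \<Longrightarrow> r (c *\<^sub>R x) = c * r x; r \<le> q\<rbrakk>
      \<Longrightarrow> r = q"
    using sublinear_minimal_exists[of p] add hom
    by (fastforce intro: order_trans)
  have q0: "q 0 = 0" using hom_q[of 2 0] by simp
  have hom_q': "q (c *\<^sub>R x) = c * q x" if "c \<ge> 0" for c x
    using hom_q[of c x] that q0 by (cases "c = 0") auto
  have super: "q x + q y \<le> q (x + y)" for x y
  proof -
    define r where "r z = (INF t\<in>{0..}. q (z + t *\<^sub>R y) - t * q y)" for z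
    have bdd: "bdd_below ((\<lambda>t. q (z + t *\<^sub>R y) - t * q y) ` {0..})" for z
    proof (rule bdd_belowI2)
      fix t :: real assume "t \<in> {0..}"
      then show "- q (- z) \<le> q (z + t *\<^sub>R y) - t * q y"
        using add_q[of "z + t *\<^sub>R y" "- z"] hom_q'[of t y] by simp
    qed
    have r_le: "r z \<le> q (z + t *\<^sub>R y) - t * q y" if "t \<ge> 0" for z t
      unfolding r_def using that by (intro cINF_lower[OF bdd]) auto
    have "r = q"
    proof (rule minimal)
      fix a b
      \<comment> \<open>The parameter for \<open>a + b\<close> is the sum of the parameters for
        \<open>a\<close> and \<open>b\<close>, and again the two infima are taken one after the
        other.\<close>
      have *: "r (a + b) \<le> (q (a + s *\<^sub>R y) - s * q y) + (q (b + t *\<^sub>R y) - t * q y)"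
        if "s \<ge> 0" "t \<ge> 0" for s t
        using r_le[of "s + t" "a + b"] add_q[of "a + s *\<^sub>R y" "b + t *\<^sub>R y"] that
        by (simp add: algebra_simps)
      have "r (a + b) - (q (b + t *\<^sub>R y) - t * q y) \<le> r a" if "t \<ge> 0" for t
        unfolding r_def[of a] using *[OF _ that] by (intro cINF_greatest) (auto simp: algebra_simps)
      then have "r (a + b) - r a \<le> r b"
        unfolding r_def[of b] by (intro cINF_greatest) (auto simp: algebra_simps)
      then show "r (a + b) \<le> r a + r b" by simp
    next
      fix c :: real and z assume c: "c > 0"
      have shift: "q (c *\<^sub>R z + t *\<^sub>R y) - t * q y = c * (q (z + (t / c) *\<^sub>R y) - (t / c) * q y)" for t
        using hom_q[OF c, of "z + (t / c) *\<^sub>R y"] c by (simp add: algebra_simps)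
      show "r (c *\<^sub>R z) = c * r z"
      proof (rule antisym)
        have "r (c *\<^sub>R z) / c \<le> r z"
          unfolding r_def[of z]
        proof (rule cINF_greatest)
          fix t :: real assume "t \<in> {0..}"
          then have "r (c *\<^sub>R z) \<le> c * (q (z + t *\<^sub>R y) - t * q y)"
            using r_le[of "c * t" "c *\<^sub>R z"] shift[of "c * t"] c by simp
          then show "r (c *\<^sub>R z) / c \<le> q (z + t *\<^sub>R y) - t * q y"
            using c by (simp add: field_simps)
        qed simp
        then show "r (c *\<^sub>R z) \<le> c * r z" using c by (simp add: field_simps)
        show "c * r z \<le> r (c *\<^sub>R z)"
          unfolding r_def[of "c *\<^sub>R z"] shift using c
          by (intro cINF_greatest mult_left_mono r_le) auto
      qed
    next
      show "r \<le> q" using r_le[of 0] by (auto simp: le_fun_def)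
    qed
    \<comment> \<open>With \<open>r = q\<close>, the parameter \<open>t = 1\<close> reads
      \<open>q x \<le> q (x + y) - q y\<close>.\<close>
    then show ?thesis using r_le[of 1 x] by simp
  qed
  have additive: "q (x + y) = q x + q y" for x y
    using add_q[of x y] super[of x y] by simp
  have neg: "q (- x) = - q x" for x using additive[of x "- x"] q0 by simp
  have "linear q"
  proof (rule linearI)
    fix c :: real and x
    show "q (c *\<^sub>R x) = c *\<^sub>R q x"
      using hom_q'[of c x] hom_q'[of "- c" x] neg[of "c *\<^sub>R x"] by (cases "c \<ge> 0") auto
  qed (rule additive)
  then show ?thesis using qp by (auto simp: le_fun_def)
qed

subsection \<open>Finitely additive means and representing measures\<close>

text \<open>Closed sets form an intersection-stable generator of the Borel sets, and the indicator
  of a closed set is a pointwise limit of continuous functions with values in \<open>[0,1]\<close>;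
  dominated convergence transfers the equality of integrals.\<close>

lemma borel_measure_eqI_continuous:
  fixes M N :: "'a::metric_space measure"
  assumes M: "finite_measure M" "sets M = sets borel" and N: "finite_measure N" "sets N = sets borel"
    and eq: "\<And>f::'a \<Rightarrow> real. continuous_on UNIV f \<Longrightarrow> (\<And>x. 0 \<le> f x \<and> f x \<le> 1) \<Longrightarrow>
      (\<integral>x. f x \<partial>M) = (\<integral>x. f x \<partial>N)"
  shows "M = N"
proof -
  interpret M: finite_measure M by fact
  interpret N: finite_measure N by fact
  have sp: "space M = UNIV" "space N = UNIV"
    using M N by (auto dest: sets_eq_imp_space_eq)
  have closed_eq: "measure M C = measure N C" if C: "closed C" for C
  proof (cases "C = {}")
    case False
    \<comment> \<open>These functions decrease to the indicator of \<open>C\<close>. The empty set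
      is treated apart because \<open>infdist\<close> to it is \<open>0\<close>.\<close>
    define f where "f n x = max 0 (1 - real n * infdist x C)" for n x
    have cont: "continuous_on UNIV (f n)" for n
      unfolding f_def by (intro continuous_intros)
    have bnd: "0 \<le> f n x \<and> f n x \<le> 1" for n x
      using infdist_nonneg[of x C] by (auto simp: f_def)
    have lim: "(\<lambda>n. f n x) \<longlonglongrightarrow> indicat_real C x" for x
    proof (cases "x \<in> C")
      case True
      then show ?thesis by (simp add: f_def)
    next
      case x: False
      then have d: "infdist x C > 0"
        using in_closed_iff_infdist_zero[OF C False] infdist_nonneg[of x C] by fastforce
      obtain n0 :: nat where "1 / infdist x C < real n0" using reals_Archimedean2 by blast
      then have n0: "1 < real n0 * infdist x C" using d by (simp add: field_simps)
      have "f n x = 0" if "n \<ge> n0" for n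
      proof -
        have "real n0 * infdist x C \<le> real n * infdist x C"
          using that d by (intro mult_right_mono) auto
        then show ?thesis using n0 by (simp add: f_def)
      qed
      then show ?thesis
        using x by (intro tendsto_eventually eventually_sequentiallyI[of n0]) auto
    qed
    have conv: "(\<lambda>n. \<integral>x. f n x \<partial>K) \<longlonglongrightarrow> measure K C"
      if K: "finite_measure K" "sets K = sets borel" for K :: "'a measure"
    proof -
      interpret K: finite_measure K by fact
      have "(\<lambda>n. \<integral>x. f n x \<partial>K) \<longlonglongrightarrow> (\<integral>x. indicat_real C x \<partial>K)"
      proof (rule integral_dominated_convergence[where w = "\<lambda>_. 1"])
        show "f n \<in> borel_measurable K" for n
          using borel_measurable_continuous_onI[OF cont] K(2) measurable_cong_sets by blast
        show "indicat_real C \<in> borel_measurable K"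
          using C K(2) by (auto intro: borel_measurable_indicator)
      qed (use lim bnd in auto)
      then show ?thesis using C K(2) by simp
    qed
    have "(\<lambda>n. \<integral>x. f n x \<partial>M) = (\<lambda>n. \<integral>x. f n x \<partial>N)" using eq[OF cont bnd] by auto
    then show ?thesis using conv[OF M] conv[OF N] LIMSEQ_unique by metis
  qed simp
  show ?thesis
  proof (rule measure_eqI_generator_eq[where E = "Collect closed" and \<Omega> = UNIV and A = "\<lambda>_. UNIV"])
    show "sets M = sigma_sets UNIV (Collect closed)" "sets N = sigma_sets UNIV (Collect closed)"
      using M(2) N(2) by (simp_all add: borel_eq_closed)
    show "emeasure M X = emeasure N X" if "X \<in> Collect closed" for X
      using closed_eq[of X] that by (simp add: M.emeasure_eq_measure N.emeasure_eq_measure)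
  qed (auto simp: Int_stable_def)
qed

lemma bounded_range_mult:
  fixes f :: "'a \<Rightarrow> real"
  shows "bounded (range f) \<Longrightarrow> bounded (range (\<lambda>x. c * f x))"
  using bounded_scaling[of "range f" c] by (simp add: image_image)

text \<open>Integration against a finitely additive probability on all subsets. The domain is
  encoded by boundedness premises; the values of \<open>L\<close> at unbounded functions are
  unconstrained.\<close>

locale bounded_mean =
  fixes L :: "('a \<Rightarrow> real) \<Rightarrow> real"
  assumes add: "\<lbrakk>bounded (range f); bounded (range g)\<rbrakk> \<Longrightarrow> L (\<lambda>x. f x + g x) = L f + L g"
    and scale: "bounded (range f) \<Longrightarrow> L (\<lambda>x. c * f x) = c * L f"
    and nonneg: "\<lbrakk>bounded (range f); \<And>x. 0 \<le> f x\<rbrakk> \<Longrightarrow> 0 \<le> L f"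
    and one: "L (\<lambda>_. 1) = 1"
begin

lemma const: "L (\<lambda>_. c) = c"
  using scale[of "\<lambda>_. 1" c] one by (simp add: image_constant_conv)

text \<open>Boundedness of the sum is part of the conclusion because additivity of \<open>L\<close>
  asks for it in the induction step.\<close>

lemma sum:
  assumes "finite I" "\<And>i. i \<in> I \<Longrightarrow> bounded (range (f i))"
  shows "L (\<lambda>x. \<Sum>i\<in>I. f i x) = (\<Sum>i\<in>I. L (f i)) \<and> bounded (range (\<lambda>x. \<Sum>i\<in>I. f i x))"
  using assms
proof (induction I rule: finite_induct)
  case empty
  then show ?case by (simp add: const image_constant_conv)
next
  case (insert i I)
  then show ?case using add[of "f i" "\<lambda>x. \<Sum>i\<in>I. f i x"] bounded_plus_comp[of "f i" UNIV]
    by simp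
qed

text \<open>With \<open>c\<close> as a uniform error, two applications turn uniform closeness of
  functions into closeness of their means.\<close>

lemma mono_const:
  assumes f: "bounded (range f)" and g: "bounded (range g)" and le: "\<And>x. f x \<le> g x + c"
  shows "L f \<le> L g + c"
proof -
  have nf: "bounded (range (\<lambda>x. -1 * f x))" by (rule bounded_range_mult[OF f])
  have gc: "bounded (range (\<lambda>x. g x + c))"
    by (intro bounded_plus_comp g) (simp add: image_constant_conv)
  have "0 \<le> L (\<lambda>x. (g x + c) + -1 * f x)"
    using le by (intro nonneg bounded_plus_comp gc nf) (simp add: le_diff_eq)
  also have "\<dots> = L g + c - L f"
    using add[OF gc nf] add[OF g, of "\<lambda>_. c"] scale[OF f, of "-1"] by (simp add: const image_constant_conv)
  finally show ?thesis by simp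
qed

text \<open>\<open>M\<close> stands for the image of the finitely additive mean under
  \<open>h\<close>. Since \<open>L\<close> evaluates every indicator function, rounding
  \<open>h\<close> to a grid gives discrete distributions on the line. They live on a bounded
  interval, so Helly's theorem supplies a weak limit.\<close>

lemma distribution_of_unit_interval_map:
  fixes h :: "'a \<Rightarrow> real"
  assumes h: "\<And>x. 0 \<le> h x" "\<And>x. h x \<le> 1"
  shows "\<exists>M. real_distribution M \<and> (\<forall>\<phi>. continuous_on UNIV \<phi> \<longrightarrow> bounded (range \<phi>) \<longrightarrow>
    (\<integral>t. \<phi> t \<partial>M) = L (\<lambda>x. \<phi> (h x)))"
proof -
  \<comment> \<open>Index of \<open>h x\<close> after rounding down to the grid of width
    \<open>1 / Suc n\<close>; the successor avoids division by zero. The top index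
    \<open>Suc n\<close> is reached only where \<open>h x = 1\<close>.\<close>
  define c where "c n x = nat \<lfloor>real (Suc n) * h x\<rfloor>" for n x
  have c_le: "c n x \<le> Suc n" for n x
  proof -
    have "real (Suc n) * h x \<le> real (Suc n)" using h(2)[of x] by (intro mult_left_le) auto
    from floor_mono[OF this] have "\<lfloor>real (Suc n) * h x\<rfloor> \<le> int (Suc n)" by (simp only: floor_of_nat)
    then show ?thesis unfolding c_def by (simp only: nat_le_iff)
  qed
  have c_close: "\<bar>real (c n x) / real (Suc n) - h x\<bar> \<le> 1 / real (Suc n)" for n x
  proof -
    have "\<bar>real (c n x) - real (Suc n) * h x\<bar> \<le> 1"
    proof -
      have "0 \<le> \<lfloor>real (Suc n) * h x\<rfloor>" using h(1)[of x] by (simp only: zero_le_floor) simp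
      then have "real (c n x) = of_int \<lfloor>real (Suc n) * h x\<rfloor>" unfolding c_def by (rule of_nat_nat)
      then show ?thesis by linarith
    qed
    then have "\<bar>real (c n x) - real (Suc n) * h x\<bar> / real (Suc n) \<le> 1 / real (Suc n)"
      by (intro divide_right_mono) auto
    moreover have "real (c n x) / real (Suc n) - h x = (real (c n x) - real (Suc n) * h x) / real (Suc n)"
      by (simp add: field_simps)
    ultimately show ?thesis by (simp add: abs_divide)
  qed
  define w where "w n i = L (indicat_real {x. c n x = i})" for n i
  have ind: "bounded (range (indicat_real A))" for A :: "'a set"
    by (rule boundedI[where B = 1]) auto
  have w_nonneg: "0 \<le> w n i" for n i unfolding w_def by (intro nonneg ind) auto
  have w_zero: "w n i = 0" if "i \<notin> {..Suc n}" for n i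
  proof -
    have "c n x \<noteq> i" for x using c_le[of n x] that by auto
    then have "indicat_real {x. c n x = i} = (\<lambda>_. 0)" by (simp add: fun_eq_iff)
    then show ?thesis by (simp add: w_def const)
  qed
  \<comment> \<open>As \<open>c n\<close> takes finitely many values, finite additivity alone
    evaluates the mean of any function of it.\<close>
  have step: "L (\<lambda>x. \<psi> (c n x)) = (\<Sum>i\<le>Suc n. \<psi> i * w n i)" for \<psi> n
  proof -
    have "(\<lambda>x. \<psi> (c n x)) = (\<lambda>x. \<Sum>i\<le>Suc n. \<psi> i * indicat_real {x. c n x = i} x)"
    proof
      fix x
      have "(\<Sum>i\<le>Suc n. \<psi> i * indicat_real {x. c n x = i} x) = (\<Sum>i\<in>{c n x}. \<psi> i * indicat_real {x. c n x = i} x)"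
        using c_le[of n x] by (intro sum.mono_neutral_right) auto
      then show "\<psi> (c n x) = (\<Sum>i\<le>Suc n. \<psi> i * indicat_real {x. c n x = i} x)" by simp
    qed
    moreover have "bounded (range (\<lambda>x. \<psi> i * indicat_real {x. c n x = i} x))" for i
      by (rule boundedI[where B = "\<bar>\<psi> i\<bar>"]) (auto split: split_indicator)
    ultimately show ?thesis
      using sum[of "{..Suc n}" "\<lambda>i x. \<psi> i * indicat_real {x. c n x = i} x"]
      by (simp add: w_def scale ind)
  qed
  have w_sum: "(\<Sum>i\<le>Suc n. w n i) = 1" for n using step[of "\<lambda>_. 1" n] by (simp add: one)
  define P where "P n = embed_pmf (w n)" for n
  have pmf_P: "pmf (P n) i = w n i" for n i
    unfolding P_def
  proof (rule pmf_embed_pmf[OF w_nonneg])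
    have "(\<integral>\<^sup>+ i. ennreal (w n i) \<partial>count_space UNIV) = (\<Sum>i\<le>Suc n. ennreal (w n i))"
      using w_zero by (intro nn_integral_count_space') auto
    also have "\<dots> = 1" using w_sum[of n] w_nonneg by (subst sum_ennreal) auto
    finally show "(\<integral>\<^sup>+ i. ennreal (w n i) \<partial>count_space UNIV) = 1" .
  qed
  have set_P: "set_pmf (P n) \<subseteq> {..Suc n}" for n
    using w_zero pmf_P by (force simp: set_pmf_iff)
  define \<nu> where "\<nu> n = distr (measure_pmf (P n)) borel (\<lambda>i. real i / real (Suc n))" for n
  have \<nu>_integral: "(\<integral>t. \<phi> t \<partial>\<nu> n) = L (\<lambda>x. \<phi> (real (c n x) / real (Suc n)))"
    if "\<phi> \<in> borel_measurable borel" for \<phi> :: "real \<Rightarrow> real" and n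
  proof -
    have "(\<integral>t. \<phi> t \<partial>\<nu> n) = (\<integral>i. \<phi> (real i / real (Suc n)) \<partial>measure_pmf (P n))"
      unfolding \<nu>_def using that by (subst integral_distr) auto
    also have "\<dots> = (\<Sum>i\<le>Suc n. \<phi> (real i / real (Suc n)) * w n i)"
      using set_P by (subst integral_measure_pmf_real[of "{..Suc n}"]) (auto simp: pmf_P)
    finally show ?thesis using step[of "\<lambda>i. \<phi> (real i / real (Suc n))"] by simp
  qed
  have "tight \<nu>"
    unfolding tight_def
  proof (intro conjI allI impI)
    show "real_distribution (\<nu> n)" for n
      unfolding \<nu>_def by (intro prob_space.real_distribution_distr prob_space_measure_pmf) simp
    fix \<epsilon> :: real assume "\<epsilon> > 0"
    \<comment> \<open>Tightness is phrased with half-open intervals; the left end \<open>-1\<close>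
      keeps a possible atom at \<open>0\<close> inside.\<close>
    have "measure (\<nu> n) {-1<..1} = 1" for n
    proof -
      have "measure (\<nu> n) {-1<..1} = measure (measure_pmf (P n)) {i. -1 < real i / real (Suc n) \<and> real i / real (Suc n) \<le> 1}"
        unfolding \<nu>_def by (subst measure_distr) (auto intro!: arg_cong[where f = "measure _"])
      also have "\<dots> = 1"
      proof -
        have "-1 < real i / real (Suc n) \<and> real i / real (Suc n) \<le> 1" if "i \<in> set_pmf (P n)" for i
        proof -
          have "i \<le> Suc n" using set_P[of n] that by auto
          then have "real i \<le> real (Suc n)" by simp
          moreover have "0 \<le> real i / real (Suc n)" by simp
          then have "-1 < real i / real (Suc n)" by linarith
          ultimately show ?thesis by (simp add: divide_le_eq)
        qed
        then show ?thesis by (subst measure_pmf.prob_eq_1) (auto simp: AE_measure_pmf_iff)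
      qed
      finally show ?thesis .
    qed
    then show "\<exists>a b. a < b \<and> (\<forall>n. measure (\<nu> n) {a<..b} > 1 - \<epsilon>)"
      using \<open>\<epsilon> > 0\<close> by (intro exI[of _ "-1"] exI[of _ 1]) auto
  qed
  then obtain r M where r: "strict_mono r" and M: "real_distribution M" and conv: "weak_conv_m (\<nu> \<circ> r) M"
    using tight_imp_convergent_subsubsequence[of \<nu> id] strict_mono_id by (auto simp: comp_def id_def)
  have \<nu>: "real_distribution ((\<nu> \<circ> r) n)" for n
    using \<open>tight \<nu>\<close> by (simp add: tight_def)
  show ?thesis
  proof (intro exI[of _ M] conjI M allI impI)
    fix \<phi> :: "real \<Rightarrow> real" assume cont: "continuous_on UNIV \<phi>" and bnd: "bounded (range \<phi>)"
    obtain B where B: "\<And>t. norm (\<phi> t) \<le> B" using bnd by (auto simp: bounded_iff)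
    have bnd': "bounded (range (\<lambda>x. \<phi> (k x)))" for k :: "'a \<Rightarrow> real"
      using B by (intro boundedI[where B = B]) auto
    have "(\<lambda>n. \<integral>t. \<phi> t \<partial>((\<nu> \<circ> r) n)) \<longlonglongrightarrow> (\<integral>t. \<phi> t \<partial>M)"
      using cont B by (intro weak_conv_imp_integral_bdd_continuous_conv[OF \<nu> M conv])
        (auto simp: continuous_on_eq_continuous_at)
    \<comment> \<open>This limit holds along the whole sequence: a continuous \<open>\<phi>\<close>
      is uniformly continuous on \<open>[0,1]\<close>, and the rounding error is at most the grid
      width. It identifies the weak limit found along \<open>r\<close>.\<close>
    moreover have "(\<lambda>n. \<integral>t. \<phi> t \<partial>\<nu> n) \<longlonglongrightarrow> L (\<lambda>x. \<phi> (h x))"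
    proof (rule LIMSEQ_I)
      fix \<epsilon> :: real assume \<epsilon>: "\<epsilon> > 0"
      have "uniformly_continuous_on {0..1} \<phi>"
        using cont continuous_on_subset by (intro compact_uniformly_continuous) auto
      then obtain d where d: "d > 0"
        "\<And>s t. \<lbrakk>s \<in> {0..1}; t \<in> {0..1}; dist t s < d\<rbrakk> \<Longrightarrow> dist (\<phi> t) (\<phi> s) < \<epsilon> / 2"
        using \<epsilon> unfolding uniformly_continuous_on_def by (metis half_gt_zero)
      obtain n0 where n0: "1 / real (Suc n0) < d" using d(1) by (rule nat_approx_posE)
      have "norm ((\<integral>t. \<phi> t \<partial>\<nu> n) - L (\<lambda>x. \<phi> (h x))) < \<epsilon>" if "n \<ge> n0" for n
      proof -
        have close: "\<bar>\<phi> (real (c n x) / real (Suc n)) - \<phi> (h x)\<bar> < \<epsilon> / 2" for x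
        proof -
          have "1 / real (Suc n) \<le> 1 / real (Suc n0)" using that by (simp add: field_simps)
          then have "dist (real (c n x) / real (Suc n)) (h x) < d"
            using c_close[of n x] n0 by (simp add: dist_real_def)
          moreover have "real (c n x) / real (Suc n) \<in> {0..1}"
            using c_le[of n x] by (simp add: divide_le_eq)
          ultimately show ?thesis using d(2)[of "h x"] h[of x] by (simp add: dist_real_def)
        qed
        have "L (\<lambda>x. \<phi> (real (c n x) / real (Suc n))) \<le> L (\<lambda>x. \<phi> (h x)) + \<epsilon> / 2"
        proof (intro mono_const bnd')
          show "\<phi> (real (c n x) / real (Suc n)) \<le> \<phi> (h x) + \<epsilon> / 2" for x
            using close[of x] by linarith
        qed
        moreover have "L (\<lambda>x. \<phi> (h x)) \<le> L (\<lambda>x. \<phi> (real (c n x) / real (Suc n))) + \<epsilon> / 2"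
        proof (intro mono_const bnd')
          show "\<phi> (h x) \<le> \<phi> (real (c n x) / real (Suc n)) + \<epsilon> / 2" for x
            using close[of x] by linarith
        qed
        ultimately show ?thesis
          using \<epsilon> \<nu>_integral[of \<phi> n] borel_measurable_continuous_onI[OF cont] by (simp add: abs_less_iff)
      qed
      then show "\<exists>n0. \<forall>n\<ge>n0. norm ((\<integral>t. \<phi> t \<partial>\<nu> n) - L (\<lambda>x. \<phi> (h x))) < \<epsilon>" by blast
    qed
    from LIMSEQ_subseq_LIMSEQ[OF this r]
    have "(\<lambda>n. \<integral>t. \<phi> t \<partial>((\<nu> \<circ> r) n)) \<longlonglongrightarrow> L (\<lambda>x. \<phi> (h x))" by (simp add: comp_def)
    ultimately show "(\<integral>t. \<phi> t \<partial>M) = L (\<lambda>x. \<phi> (h x))" by (rule LIMSEQ_unique)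
  qed
qed

end

section \<open>Coding a compact metric space by ternary expansions\<close>

text \<open>
  The digits will be the membership bits of a separating sequence of sets; avoiding the digit \<open>1\<close>
  makes the digits depend continuously on the number.
\<close>

definition ternary :: "(nat \<Rightarrow> bool) \<Rightarrow> real" where
  "ternary b = (\<Sum>k. 2 * of_bool (b k) / 3 ^ Suc k)"

lemma ternary_summable: "summable (\<lambda>k. 2 * of_bool (b k) / 3 ^ Suc k :: real)"
proof (rule summable_comparison_test')
  show "summable (\<lambda>k. 2 / 3 * (1 / 3) ^ k :: real)" by (intro summable_mult summable_geometric) auto
qed (auto simp: power_one_over)

lemma ternary_bounds: "0 \<le> ternary b" "ternary b \<le> 1"
proof -
  show "0 \<le> ternary b" unfolding ternary_def by (intro suminf_nonneg ternary_summable) auto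
  have "(\<lambda>k. 2 / 3 * (1 / 3) ^ k :: real) sums (2 / 3 * (1 / (1 - 1 / 3)))"
    by (intro sums_mult geometric_sums) auto
  then have s: "(\<lambda>k. 2 / 3 * (1 / 3) ^ k :: real) sums 1" by simp
  have "ternary b \<le> (\<Sum>k. 2 / 3 * (1 / 3) ^ k)"
    unfolding ternary_def
    by (intro suminf_le ternary_summable sums_summable[OF s]) (auto simp: power_one_over)
  then show "ternary b \<le> 1" using sums_unique[OF s] by simp
qed

text \<open>Self-similarity of the Cantor set, which makes induction over the digits
  possible.\<close>

lemma ternary_shift: "3 * ternary b = 2 * of_bool (b 0) + ternary (\<lambda>k. b (Suc k))"
proof -
  have "ternary b = 2 * of_bool (b 0) / 3 + (\<Sum>k. 2 * of_bool (b (Suc k)) / 3 ^ Suc (Suc k))"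
    using suminf_split_head[OF ternary_summable[of b]] unfolding ternary_def by simp
  also have "(\<Sum>k. 2 * of_bool (b (Suc k)) / 3 ^ Suc (Suc k)) = ternary (\<lambda>k. b (Suc k)) / 3"
    unfolding ternary_def by (subst suminf_divide[OF ternary_summable, symmetric]) (simp add: field_simps)
  finally show ?thesis by simp
qed

text \<open>Digits are \<open>0\<close> or \<open>2\<close> and tails lie in \<open>[0,1]\<close>,
  so different leading digits would put the tripled numbers at distance at least \<open>1\<close>.
  Equal leading digits cancel, and the tails are compared at the next scale.\<close>

lemma ternary_close_imp_agree:
  assumes "\<bar>ternary a - ternary b\<bar> < 1 / 3 ^ n" "k < n"
  shows "a k = b k"
  using assms
proof (induction n arbitrary: a b k)
  case (Suc n)
  have "3 * \<bar>ternary a - ternary b\<bar> < 1 / 3 ^ n" using Suc.prems(1) by (simp add: field_simps)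
  then have *: "\<bar>3 * ternary a - 3 * ternary b\<bar> < 1 / 3 ^ n" by (simp add: abs_if split: if_splits)
  have "(1::real) / 3 ^ n \<le> 1" by simp
  with * have "\<bar>3 * ternary a - 3 * ternary b\<bar> < 1" by linarith
  then have head: "a 0 = b 0"
    using ternary_bounds[of "\<lambda>k. a (Suc k)"] ternary_bounds[of "\<lambda>k. b (Suc k)"]
    unfolding ternary_shift by (cases "a 0"; cases "b 0") auto
  show ?case
  proof (cases k)
    case (Suc j)
    have "\<bar>ternary (\<lambda>k. a (Suc k)) - ternary (\<lambda>k. b (Suc k))\<bar> < 1 / 3 ^ n"
      using * head unfolding ternary_shift by simp
    from Suc.IH[OF this, of j] Suc Suc.prems(2) show ?thesis by simp
  qed (use head in simp)
qed simp

text \<open>\<open>U\<close> enumerates all balls of radius \<open>1 / Suc m\<close> around finite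
  nets, for every \<open>m\<close>. The balls of one scale occupy finitely many indices and cover
  the space, so points with equal membership there lie in a common ball of that scale.\<close>

lemma compact_separating_sequence:
  assumes "compact (UNIV :: 'a::metric_space set)"
  obtains U :: "nat \<Rightarrow> 'a::metric_space set"
  where "\<And>\<epsilon>. \<epsilon> > 0 \<Longrightarrow> \<exists>n. \<forall>x y. (\<forall>k<n. x \<in> U k \<longleftrightarrow> y \<in> U k) \<longrightarrow> dist x y < \<epsilon>"
proof -
  have "\<exists>K::'a set. finite K \<and> UNIV \<subseteq> (\<Union>x\<in>K. ball x (1 / real (Suc m)))" for m
    using seq_compact_imp_totally_bounded[OF assms[unfolded compact_eq_seq_compact_metric],
        rule_format, of "1 / real (Suc m)"]
    by auto
  then obtain K :: "nat \<Rightarrow> 'a set" where K: "\<And>m. finite (K m)"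
    "\<And>m. UNIV \<subseteq> (\<Union>x\<in>K m. ball x (1 / real (Suc m)))" by metis
  define \<B> where "\<B> = (\<Union>m. (\<lambda>x. ball x (1 / real (Suc m))) ` K m)"
  have "countable \<B>" using K(1) by (auto simp: \<B>_def intro: countable_finite)
  have "K 0 \<noteq> {}" using K(2)[of 0] by force
  then have "\<B> \<noteq> {}" by (auto simp: \<B>_def)
  define U where "U = from_nat_into \<B>"
  have range_U: "range U = \<B>" unfolding U_def by (rule range_from_nat_into) fact+
  show thesis
  proof (rule that)
    fix \<epsilon> :: real assume "\<epsilon> > 0"
    then obtain m where m: "1 / real (Suc m) < \<epsilon> / 2" using nat_approx_posE half_gt_zero by metis
    let ?B = "(\<lambda>x. ball x (1 / real (Suc m))) ` K m"
    have "finite ?B" "?B \<subseteq> range U" using K(1) by (auto simp: range_U \<B>_def)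
    then obtain I where I: "finite I" "?B = U ` I" using finite_subset_image by metis
    obtain n where n: "\<And>i. i \<in> I \<Longrightarrow> i < n" using I(1) finite_nat_set_iff_bounded by auto
    have "dist x y < \<epsilon>" if "\<forall>k<n. x \<in> U k \<longleftrightarrow> y \<in> U k" for x y
    proof -
      have "x \<in> (\<Union>z\<in>K m. ball z (1 / real (Suc m)))" using K(2)[of m] by blast
      then obtain z where z: "z \<in> K m" "x \<in> ball z (1 / real (Suc m))" by blast
      have "ball z (1 / real (Suc m)) \<in> U ` I" unfolding I(2)[symmetric] using z(1) by (rule imageI)
      then obtain i where i: "i \<in> I" "U i = ball z (1 / real (Suc m))" by auto
      then have "y \<in> ball z (1 / real (Suc m))" using that n z(2) by blast
      then show ?thesis using z(2) m dist_triangle3[of x y z] unfolding mem_ball by linarith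
    qed
    then show "\<exists>n. \<forall>x y. (\<forall>k<n. x \<in> U k \<longleftrightarrow> y \<in> U k) \<longrightarrow> dist x y < \<epsilon>" by blast
  qed
qed

text \<open>\<open>h\<close> codes a point by its membership bits in a separating sequence. It may
  be discontinuous, but close codes force close points, so its inverse extends to a continuous
  \<open>g\<close> on a compact set of reals containing all codes.\<close>

lemma compact_quotient_of_unit_interval_subset:
  assumes X: "compact (UNIV :: 'a::metric_space set)"
  obtains h :: "'a::metric_space \<Rightarrow> real" and K g where "\<And>x. 0 \<le> h x" "\<And>x. h x \<le> 1" "compact K" "range h \<subseteq> K"
    "continuous_on K g" "\<And>x. g (h x) = x"
proof -
  obtain U :: "nat \<Rightarrow> 'a set"
    where U: "\<And>\<epsilon>. \<epsilon> > 0 \<Longrightarrow> \<exists>n. \<forall>x y. (\<forall>k<n. x \<in> U k \<longleftrightarrow> y \<in> U k) \<longrightarrow> dist x y < \<epsilon>"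
    using compact_separating_sequence[OF X] by blast
  define h where "h x = ternary (\<lambda>k. x \<in> U k)" for x
  have h: "0 \<le> h x" "h x \<le> 1" for x by (simp_all add: h_def ternary_bounds)
  have inv: "\<exists>d>0. \<forall>x y. \<bar>h x - h y\<bar> < d \<longrightarrow> dist x y < \<epsilon>" if "\<epsilon> > 0" for \<epsilon>
  proof -
    obtain n where n: "\<And>x y. (\<forall>k<n. x \<in> U k \<longleftrightarrow> y \<in> U k) \<Longrightarrow> dist x y < \<epsilon>"
      using U[OF \<open>\<epsilon> > 0\<close>] by blast
    have "dist x y < \<epsilon>" if "\<bar>h x - h y\<bar> < 1 / 3 ^ n" for x y
      using n[of x y] ternary_close_imp_agree[OF that[unfolded h_def]] by blast
    then show ?thesis by (intro exI[of _ "1 / 3 ^ n"]) auto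
  qed
  txt \<open>The inverse of \<open>h\<close> extends continuously to the closure of the range: the closed graph is
    compact and projects injectively to the line.\<close>
  define Z where "Z = closure (range (\<lambda>x. (x, h x)))"
  have "Z \<subseteq> UNIV \<times> {0..1}"
    unfolding Z_def using h by (intro closure_minimal closed_Times) auto
  moreover have "compact (UNIV \<times> {0..1} :: ('a \<times> real) set)" by (intro compact_Times X) auto
  ultimately have Z: "compact Z"
    using compact_Int_closed[of "UNIV \<times> {0..1}" Z] by (simp add: Z_def Int_absorb1)
  have inj: "inj_on snd Z"
  proof (rule inj_onI, clarsimp)
    fix x y t assume xt: "(x, t) \<in> Z" and yt: "(y, t) \<in> Z"
    \<comment> \<open>Both points are \<epsilon>-close to points whose codes are near
      \<open>t\<close>, hence near each other; three steps of length at most \<epsilon> lead from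
      \<open>x\<close> to \<open>y\<close>.\<close>
    have "dist x y \<le> 3 * \<epsilon>" if \<epsilon>: "\<epsilon> > 0" for \<epsilon>
    proof -
      obtain d where d: "d > 0" "\<And>x y. \<bar>h x - h y\<bar> < d \<Longrightarrow> dist x y < \<epsilon>" using inv[OF \<epsilon>] by blast
      have near: "\<exists>x'. dist x' x < \<epsilon> \<and> dist (h x') t < d / 2" if "(x, t) \<in> Z" for x
      proof -
        have "min \<epsilon> (d / 2) > 0" using d(1) \<epsilon> by simp
        then obtain x' where x': "dist (x', h x') (x, t) < min \<epsilon> (d / 2)"
          using \<open>(x, t) \<in> Z\<close> unfolding Z_def closure_approachable by blast
        then show ?thesis
          using dist_fst_le[of "(x', h x')" "(x, t)"] dist_snd_le[of "(x', h x')" "(x, t)"]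
          by (intro exI[of _ x']) auto
      qed
      obtain x' y' where x': "dist x' x < \<epsilon>" "dist (h x') t < d / 2"
        and y': "dist y' y < \<epsilon>" "dist (h y') t < d / 2"
        using near[OF xt] near[OF yt] by blast
      have "\<bar>h x' - h y'\<bar> < d" using x'(2) y'(2) unfolding dist_real_def by linarith
      from d(2)[OF this] show ?thesis
        using x'(1) y'(1) dist_triangle[of x y x'] dist_triangle[of x' y y'] by (simp add: dist_commute)
    qed
    \<comment> \<open>For \<open>x \<noteq> y\<close> this choice would bound the distance by three
      quarters of itself.\<close>
    from this[of "dist x y / 4"] show "x = y" by (cases "x = y") auto
  qed
  show thesis
  proof (rule that[OF h])
    show "compact (snd ` Z)" by (intro compact_continuous_image Z continuous_intros)
    have hZ: "(x, h x) \<in> Z" for x unfolding Z_def using closure_subset by fastforce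
    then show "range h \<subseteq> snd ` Z" by force
    have "continuous_on (snd ` Z) (inv_into Z snd)"
      using inj by (intro continuous_on_inv Z continuous_intros) auto
    then show "continuous_on (snd ` Z) (\<lambda>t. fst (inv_into Z snd t))" by (intro continuous_intros)
    show "fst (inv_into Z snd (h x)) = x" for x
      using inv_into_f_f[OF inj hZ[of x]] by simp
  qed
qed


section \<open>Riesz representation on compact metric spaces\<close>

text \<open>The law \<open>M\<close> of the coding \<open>h\<close> is carried by \<open>K\<close>,
  and its image under \<open>g\<close> represents \<open>L\<close> on continuous functions because
  \<open>g\<close> undoes \<open>h\<close>.\<close>

theorem bounded_mean_representing_measure:
  fixes L :: "('a::metric_space \<Rightarrow> real) \<Rightarrow> real"
  assumes X: "compact (UNIV :: 'a set)" and L: "bounded_mean L"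
  obtains \<mu> :: "'a measure" where "prob_space \<mu>" "sets \<mu> = sets borel"
    and "\<And>f. continuous_on UNIV f \<Longrightarrow> (\<integral>x. f x \<partial>\<mu>) = L f"
proof -
  interpret bounded_mean L by fact
  obtain h :: "'a \<Rightarrow> real" and K g where h: "\<And>x. 0 \<le> h x" "\<And>x. h x \<le> 1"
    and K: "compact K" "range h \<subseteq> K" and g: "continuous_on K g" "\<And>x. g (h x) = x"
    using compact_quotient_of_unit_interval_subset[OF X] by blast
  obtain M where M: "real_distribution M"
    and "\<forall>\<phi>. continuous_on UNIV \<phi> \<longrightarrow> bounded (range \<phi>) \<longrightarrow> (\<integral>t. \<phi> t \<partial>M) = L (\<lambda>x. \<phi> (h x))"
    using distribution_of_unit_interval_map[of h, OF h] by auto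
  note int = this(2)[rule_format]
  interpret M: real_distribution M by fact
  have K_closed: "closed K" "K \<noteq> {}" using K compact_imp_closed by auto
  \<comment> \<open>The truncated distance to \<open>K\<close> vanishes on the range of
    \<open>h\<close>, hence has integral \<open>0\<close>; being nonnegative, it vanishes almost
    everywhere.\<close>
  have AE_K: "AE t in M. t \<in> K"
  proof -
    define \<phi> where "\<phi> t = min 1 (infdist t K)" for t
    have \<phi>: "continuous_on UNIV \<phi>" "\<And>t. 0 \<le> \<phi> t" "\<And>t. \<phi> t \<le> 1"
      unfolding \<phi>_def by (auto intro!: continuous_intros infdist_nonneg)
    have bnd: "bounded (range \<phi>)" using \<phi>(2,3) by (intro boundedI[where B = 1]) auto
    have "\<phi> (h x) = 0" for x using K(2) by (simp add: \<phi>_def range_subsetD)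
    then have "(\<integral>t. \<phi> t \<partial>M) = 0" using int[OF \<phi>(1) bnd] by (simp add: const)
    moreover have "integrable M \<phi>"
      using \<phi> borel_measurable_continuous_onI[OF \<phi>(1)]
      by (intro M.integrable_const_bound[where B = 1]) auto
    ultimately have "AE t in M. \<phi> t = 0"
      using \<phi>(2) by (subst (asm) integral_nonneg_eq_0_iff_AE) auto
    then show ?thesis
    proof eventually_elim
      case (elim t)
      then have "infdist t K = 0" by (simp add: \<phi>_def min_def split: if_splits)
      then show ?case using in_closed_iff_infdist_zero[OF K_closed] by blast
    qed
  qed
  \<comment> \<open>The value outside \<open>K\<close> is arbitrary, since it is taken only on an
    \<open>M\<close>-null set; \<open>G\<close> is Borel because \<open>K\<close> is closed.\<close>
  define G where "G t = (if t \<in> K then g t else undefined)" for t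
  have G: "G \<in> borel_measurable borel"
    unfolding G_def using K_closed g(1) by (intro borel_measurable_continuous_on_if) auto
  show thesis
  proof (rule that)
    show "prob_space (distr M borel G)" using G by (intro M.prob_space_distr) simp
    show "sets (distr M borel G) = sets borel" by simp
    fix f :: "'a \<Rightarrow> real" assume f: "continuous_on UNIV f"
    have "bounded (range f)" by (intro compact_imp_bounded compact_continuous_image f X)
    then obtain B where B: "\<And>x. norm (f x) \<le> B" by (auto simp: bounded_iff)
    have "continuous_on K (\<lambda>t. f (g t))" by (rule continuous_on_compose2[OF f g(1)]) auto
    \<comment> \<open>The representation of \<open>L\<close> by \<open>M\<close> speaks of bounded
      continuous functions on the whole line, so \<open>f \<circ> g\<close> is extended from
      \<open>K\<close> by Tietze's theorem with the same bound.\<close>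
    then obtain \<phi> where \<phi>: "continuous_on UNIV \<phi>" "\<And>t. t \<in> K \<Longrightarrow> \<phi> t = f (g t)" "\<And>t. norm (\<phi> t) \<le> B"
      using Tietze[of K "\<lambda>t. f (g t)" UNIV B] K_closed B norm_ge_zero order_trans
      by (metis UNIV_I closed_closedin subtopology_UNIV)
    have "(\<integral>x. f x \<partial>distr M borel G) = (\<integral>t. f (G t) \<partial>M)"
      using G borel_measurable_continuous_onI[OF f] by (subst integral_distr) auto
    also have "\<dots> = (\<integral>t. \<phi> t \<partial>M)"
    proof (rule integral_cong_AE)
      show "(\<lambda>t. f (G t)) \<in> borel_measurable M"
        using measurable_compose[OF G borel_measurable_continuous_onI[OF f]] by simp
      show "\<phi> \<in> borel_measurable M" using borel_measurable_continuous_onI[OF \<phi>(1)] by simp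
      show "AE t in M. f (G t) = \<phi> t" using AE_K by eventually_elim (simp add: G_def \<phi>(2))
    qed
    also have "\<dots> = L (\<lambda>x. \<phi> (h x))" using \<phi>(3) by (intro int \<phi>(1) boundedI[where B = B]) auto
    also have "(\<lambda>x. \<phi> (h x)) = f" using \<phi>(2) K(2) g(2) by (auto simp: range_subsetD)
    finally show "(\<integral>x. f x \<partial>distr M borel G) = L f" .
  qed
qed

section \<open>Subgradients of convex functionals as measures\<close>

text \<open>Hahn-Banach on all bounded functions. The discrete copy of the type makes them a vector
  space type, to which the linear minorant theorem applies. The bound \<open>upper\<close>, used for
  \<open>- f\<close> with \<open>f \<ge> 0\<close> and for the constants \<open>1\<close> and
  \<open>-1\<close>, makes the linear minorant positive and normalised.\<close>

lemma bounded_mean_dominated: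
  fixes p :: "('a discrete \<Rightarrow>\<^sub>C real) \<Rightarrow> real"
  assumes add: "\<And>u v. p (u + v) \<le> p u + p v"
    and hom: "\<And>c u. c > 0 \<Longrightarrow> p (c *\<^sub>R u) = c * p u"
    and upper: "\<And>u b. (\<And>x. apply_bcontfun u x \<le> b) \<Longrightarrow> p u \<le> b"
  obtains L where "bounded_mean L"
    and "\<And>f. bounded (range f) \<Longrightarrow> L f \<le> p (Bcontfun (\<lambda>x. f (of_discrete x)))"
proof -
  obtain \<Lambda> where \<Lambda>: "linear \<Lambda>" "\<And>u. \<Lambda> u \<le> p u"
    using sublinear_dominates_linear[of p] add hom by blast
  define E :: "('a \<Rightarrow> real) \<Rightarrow> ('a discrete \<Rightarrow>\<^sub>C real)" where "E f = Bcontfun (\<lambda>x. f (of_discrete x))" for f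
  have E: "apply_bcontfun (E f) x = f (of_discrete x)" if "bounded (range f)" for f x
  proof -
    have "(\<lambda>x. f (of_discrete x)) \<in> bcontfun"
      using that unfolding bcontfun_def
      by (auto simp: continuous_on_open_vimage open_discrete intro: bounded_subset)
    then show ?thesis by (simp add: E_def Bcontfun_inverse)
  qed
  have bound: "\<Lambda> (E f) \<le> b" if "bounded (range f)" "\<And>x. f x \<le> b" for f b
    using that by (intro order_trans[OF \<Lambda>(2) upper]) (simp add: E)
  have scale: "\<Lambda> (E (\<lambda>x. c * f x)) = c * \<Lambda> (E f)" if f: "bounded (range f)" for f c
  proof -
    have "E (\<lambda>x. c * f x) = c *\<^sub>R E f"
      using f by (intro bcontfun_eqI) (simp add: E bounded_range_mult)
    then show ?thesis using linear_scale[OF \<Lambda>(1)] by simp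
  qed
  have const: "bounded (range (\<lambda>_::'a. c::real))" for c by (simp add: image_constant_conv)
  show thesis
  proof (rule that)
    show "bounded_mean (\<lambda>f. \<Lambda> (E f))"
    proof
      fix f g :: "'a \<Rightarrow> real" assume f: "bounded (range f)" and g: "bounded (range g)"
      have "E (\<lambda>x. f x + g x) = E f + E g"
        using f g by (intro bcontfun_eqI) (simp add: E bounded_plus_comp)
      then show "\<Lambda> (E (\<lambda>x. f x + g x)) = \<Lambda> (E f) + \<Lambda> (E g)" using linear_add[OF \<Lambda>(1)] by simp
    next
      fix f :: "'a \<Rightarrow> real" assume f: "bounded (range f)" and nonneg: "\<And>x. 0 \<le> f x"
      have "\<Lambda> (E (\<lambda>x. -1 * f x)) \<le> 0"
        using f nonneg by (intro bound bounded_range_mult) simp_all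
      then show "0 \<le> \<Lambda> (E f)" using scale[OF f, of "-1"] by simp
    next
      have "- 1 * \<Lambda> (E (\<lambda>_. 1)) \<le> - 1"
        unfolding scale[OF const, symmetric] by (rule bound) (simp_all add: const)
      moreover have "\<Lambda> (E (\<lambda>_. 1)) \<le> 1" by (rule bound) (simp_all add: const)
      ultimately show "\<Lambda> (E (\<lambda>_. 1)) = 1" by simp
    qed (rule scale)
    show "\<Lambda> (E f) \<le> p (Bcontfun (\<lambda>x. f (of_discrete x)))" for f
      using \<Lambda>(2)[of "E f"] by (simp add: E_def)
  qed
qed

text \<open>A linear functional below the directional derivative of \<open>Q\<close> at
  \<open>0\<close> is a subgradient. By \<open>mono\<close>, that derivative is at most any upper
  bound of its argument, which forces the functional to be a mean and hence, on continuous
  functions, integration against a probability measure.\<close>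

theorem convex_functional_subgradient_measure:
  fixes Q :: "('a::metric_space \<Rightarrow> real) \<Rightarrow> real"
  assumes X: "compact (UNIV :: 'a set)"
    and convex: "\<And>f g s. \<lbrakk>continuous_on UNIV f; continuous_on UNIV g; 0 \<le> s; s \<le> 1\<rbrakk> \<Longrightarrow>
      Q (\<lambda>x. s * f x + (1 - s) * g x) \<le> s * Q f + (1 - s) * Q g"
    and mono: "\<And>f g c. \<lbrakk>continuous_on UNIV f; continuous_on UNIV g; \<And>x. f x \<le> g x + c\<rbrakk> \<Longrightarrow>
      Q f \<le> Q g + c"
  obtains \<mu> :: "'a measure" where "prob_space \<mu>" "sets \<mu> = sets borel"
    and "\<And>f. continuous_on UNIV f \<Longrightarrow> Q (\<lambda>_. 0) + (\<integral>x. f x \<partial>\<mu>) \<le> Q f"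
proof -
  txt \<open>\<open>p\<close> is the directional derivative of \<open>Q\<close> at \<open>0\<close>, extended to all bounded functions by
    majorization with continuous ones. Taking the infimum over \<open>t\<close> and \<open>f\<close> simultaneously makes
    subadditivity a single instance of convexity. Since \<open>'a discrete\<close> carries the discrete topology,
    \<open>'a discrete \<Rightarrow>\<^sub>C real\<close> is the space of all bounded functions on \<open>'a\<close>.\<close>
  define A :: "('a discrete \<Rightarrow>\<^sub>C real) \<Rightarrow> (real \<times> ('a \<Rightarrow> real)) set"
    where "A u = {(t, f). t > 0 \<and> continuous_on UNIV f \<and> (\<forall>x. apply_bcontfun u (discrete x) \<le> f x)}" for u
  define q where "q = (\<lambda>(t, f). (Q (\<lambda>x. t * f x) - Q (\<lambda>_. 0)) / t)"
  define p where "p u = (INF z\<in>A u. q z)" for u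
  \<comment> \<open>A lower bound of \<open>u\<close> bounds all difference quotients from below, so
    the infimum defining \<open>p u\<close> is finite.\<close>
  have low: "b \<le> q z" if z: "z \<in> A u" and b: "\<And>x. b \<le> apply_bcontfun u x" for b u z
  proof -
    obtain t f where tf: "z = (t, f)" "t > 0" "continuous_on UNIV f" "\<And>x. apply_bcontfun u (discrete x) \<le> f x"
      using z by (auto simp: A_def)
    have "0 \<le> t * f x - t * b" for x
      using tf(2) order_trans[OF b tf(4), of x] by (simp add: mult_left_mono)
    then have "Q (\<lambda>_. 0) \<le> Q (\<lambda>x. t * f x) + - (t * b)"
      using tf(3) by (intro mono continuous_intros) auto
    then show ?thesis using tf(1,2) by (simp add: q_def field_simps)
  qed
  have bdd: "bdd_below (q ` A u)" for u
  proof -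
    obtain B where "\<And>x. norm (apply_bcontfun u x) \<le> B" using bounded_apply_bcontfun[of u] by (auto simp: bounded_iff)
    then have "- B \<le> apply_bcontfun u x" for x by (simp add: abs_le_iff minus_le_iff)
    then show ?thesis by (intro bdd_belowI2[of _ "- B"] low)
  qed
  have p_le: "p u \<le> q z" if "z \<in> A u" for u z
    unfolding p_def by (rule cINF_lower[OF bdd that])
  have p_le': "p u \<le> Q f - Q (\<lambda>_. 0)" if "continuous_on UNIV f" "\<And>x. apply_bcontfun u (discrete x) \<le> f x" for u f
    using p_le[of "(1, f)" u] that by (simp add: A_def q_def)
  have upper: "p u \<le> b" if "\<And>x. apply_bcontfun u x \<le> b" for u b
  proof -
    have "p u \<le> Q (\<lambda>_. b) - Q (\<lambda>_. 0)" using that by (intro p_le') auto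
    also have "\<dots> \<le> b" using mono[of "\<lambda>_. b" "\<lambda>_. 0" b] by simp
    finally show ?thesis .
  qed
  have ne: "A u \<noteq> {}" for u
  proof -
    obtain B where "\<And>x. norm (apply_bcontfun u x) \<le> B" using bounded_apply_bcontfun[of u] by (auto simp: bounded_iff)
    then have "(1, \<lambda>_. B) \<in> A u" by (auto simp: A_def abs_le_iff)
    then show ?thesis by blast
  qed
  have add: "p (u + v) \<le> p u + p v" for u v
  proof -
    have *: "p (u + v) \<le> q y + q z" if yz: "y \<in> A u" "z \<in> A v" for y z
    proof -
      obtain s f where sf: "y = (s, f)" "s > 0" "continuous_on UNIV f" "\<And>x. apply_bcontfun u (discrete x) \<le> f x"
        using yz(1) by (auto simp: A_def)
      obtain t g where tg: "z = (t, g)" "t > 0" "continuous_on UNIV g" "\<And>x. apply_bcontfun v (discrete x) \<le> g x"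
        using yz(2) by (auto simp: A_def)
      \<comment> \<open>The weight solves \<open>\<theta> * s = (1 - \<theta>) * t\<close>. The
        convex combination of \<open>s * f\<close> and \<open>t * g\<close> is then a multiple of
        \<open>f + g\<close>, and the factor \<open>s * t / (s + t)\<close> is the new
        parameter.\<close>
      define \<theta> where "\<theta> = t / (s + t)"
      have "s + t > 0" using sf(2) tg(2) by simp
      then have \<theta>: "0 \<le> \<theta>" "\<theta> \<le> 1" "1 - \<theta> = s / (s + t)"
        using sf(2) tg(2) unfolding \<theta>_def by (simp_all add: divide_simps)
      have r: "\<theta> * s = s * t / (s + t)" "(1 - \<theta>) * t = s * t / (s + t)" unfolding \<theta>(3) by (simp_all add: \<theta>_def)
      have "(s * t / (s + t), \<lambda>x. f x + g x) \<in> A (u + v)"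
        using sf tg by (auto simp: A_def intro!: continuous_intros add_mono)
      then have "p (u + v) \<le> q (s * t / (s + t), \<lambda>x. f x + g x)" by (rule p_le)
      also have "Q (\<lambda>x. s * t / (s + t) * (f x + g x)) =
          Q (\<lambda>x. \<theta> * (s * f x) + (1 - \<theta>) * (t * g x))"
        by (simp only: mult.assoc[symmetric] r distrib_left)
      then have "q (s * t / (s + t), \<lambda>x. f x + g x) \<le>
          (\<theta> * Q (\<lambda>x. s * f x) + (1 - \<theta>) * Q (\<lambda>x. t * g x) - Q (\<lambda>_. 0)) / (s * t / (s + t))"
        using convex[OF continuous_on_mult_left[OF sf(3), of s] continuous_on_mult_left[OF tg(3), of t] \<theta>(1,2)] sf(2) tg(2)
        unfolding q_def by (auto intro!: divide_right_mono)
      \<comment> \<open>Dividing by the new parameter turns the weights \<open>\<theta>\<close> and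
        \<open>1 - \<theta>\<close> into \<open>1 / s\<close> and \<open>1 / t\<close>.\<close>
      also have "\<dots> = q y + q z"
      proof -
        have \<theta>st: "\<theta> * (s + t) = t" "(1 - \<theta>) * (s + t) = s"
          using \<open>s + t > 0\<close> unfolding \<theta>(3) by (simp_all add: \<theta>_def)
        have "(\<theta> * a + (1 - \<theta>) * b - c) * (s + t) =
            (\<theta> * (s + t)) * (a - c) + ((1 - \<theta>) * (s + t)) * (b - c)" for a b c
          by (simp add: algebra_simps)
        then have "\<theta> * a + (1 - \<theta>) * b - c = (t * (a - c) + s * (b - c)) / (s + t)" for a b c
          using \<open>s + t > 0\<close> unfolding \<theta>st by (simp add: eq_divide_eq)
        then have "(\<theta> * a + (1 - \<theta>) * b - c) / (s * t / (s + t)) = (t * (a - c) + s * (b - c)) / (s * t)" for a b c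
          using \<open>s + t > 0\<close> by simp
        moreover have "(t * (a - c) + s * (b - c)) / (s * t) = (a - c) / s + (b - c) / t" for a b c
          using sf(2) tg(2) by (simp add: add_divide_distrib)
        ultimately show ?thesis unfolding sf(1) tg(1) q_def by simp
      qed
      finally show ?thesis .
    qed
    have "p (u + v) - q z \<le> p u" if "z \<in> A v" for z
      unfolding p_def[of u] using *[OF _ that] by (intro cINF_greatest ne) (simp add: algebra_simps)
    then have "p (u + v) - p u \<le> p v"
      unfolding p_def[of v] by (intro cINF_greatest ne) (simp add: algebra_simps)
    then show ?thesis by simp
  qed
  have hom_le: "p (c *\<^sub>R u) \<le> c * p u" if c: "c > 0" for c u
  proof -
    have "p (c *\<^sub>R u) / c \<le> p u"
      unfolding p_def[of u]
    proof (rule cINF_greatest[OF ne])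
      fix z assume "z \<in> A u"
      then obtain t f where tf: "z = (t, f)" "t > 0" "continuous_on UNIV f" "\<And>x. apply_bcontfun u (discrete x) \<le> f x"
        by (auto simp: A_def)
      \<comment> \<open>The product \<open>t / c * (c * f)\<close> is still \<open>t * f\<close>, so
        only the denominator of the difference quotient changes.\<close>
      then have "(t / c, \<lambda>x. c * f x) \<in> A (c *\<^sub>R u)" using c by (auto simp: A_def intro!: continuous_intros)
      from p_le[OF this] show "p (c *\<^sub>R u) / c \<le> q z" using c tf(1,2) by (simp add: q_def field_simps)
    qed
    then show ?thesis using c by (simp add: field_simps)
  qed
  \<comment> \<open>The reverse inequality is the same one for the factor \<open>1 / c\<close> and
    the vector \<open>c *\<^sub>R u\<close>.\<close>
  have hom: "p (c *\<^sub>R u) = c * p u" if c: "c > 0" for c u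
    using hom_le[OF c, of u] hom_le[of "1 / c" "c *\<^sub>R u"] c by (intro antisym) (auto simp: field_simps)
  obtain L where L: "bounded_mean L"
    and L_le: "\<And>f. bounded (range f) \<Longrightarrow> L f \<le> p (Bcontfun (\<lambda>x. f (of_discrete x)))"
    using bounded_mean_dominated[OF add hom upper] by blast
  obtain \<mu> :: "'a measure" where \<mu>: "prob_space \<mu>" "sets \<mu> = sets borel"
    and int: "\<And>f. continuous_on UNIV f \<Longrightarrow> (\<integral>x. f x \<partial>\<mu>) = L f"
    using bounded_mean_representing_measure[OF X L] by blast
  show thesis
  proof (rule that[OF \<mu>])
    fix f :: "'a \<Rightarrow> real" assume f: "continuous_on UNIV f"
    have b: "bounded (range f)" by (intro compact_imp_bounded compact_continuous_image f X)
    then have "(\<lambda>x. f (of_discrete x)) \<in> bcontfun"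
      unfolding bcontfun_def by (auto simp: continuous_on_open_vimage open_discrete intro: bounded_subset)
    then have "p (Bcontfun (\<lambda>x. f (of_discrete x))) \<le> Q f - Q (\<lambda>_. 0)"
      by (intro p_le' f) (simp add: Bcontfun_inverse discrete_inverse)
    then show "Q (\<lambda>_. 0) + (\<integral>x. f x \<partial>\<mu>) \<le> Q f" using L_le[OF b] int[OF f] by simp
  qed
qed

subsection \<open>The polynomial pressure as a convex functional\<close>

context
  fixes T :: "'a::metric_space \<Rightarrow> 'a"
  assumes X: "compact (UNIV :: 'a set)" and T: "continuous_on UNIV T"
begin

lemma separated_sum_le_sup:
  assumes "continuous_on UNIV f" "n \<ge> 1" "\<epsilon> > 0" "bowen_separated T n \<epsilon> E"
  shows "(\<Sum>x\<in>E. exp (log_birkhoff_sum T f n x)) \<le> separated_sum_sup T f n \<epsilon>"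
  unfolding separated_sum_sup_def using assms
  by (intro cSUP_upper bdd_above_separated_sums X T) auto

lemma separated_sum_sup_le:
  assumes "\<And>E. bowen_separated T n \<epsilon> E \<Longrightarrow> (\<Sum>x\<in>E. exp (log_birkhoff_sum T f n x)) \<le> B"
  shows "separated_sum_sup T f n \<epsilon> \<le> B"
  unfolding separated_sum_sup_def using assms
  by (intro cSUP_least) (auto simp: bowen_separated_def intro: exI[of _ "{}"])

lemma separated_sum_sup_pos:
  assumes "continuous_on UNIV f" "n \<ge> 1" "\<epsilon> > 0"
  shows "0 < separated_sum_sup T f n \<epsilon>"
proof -
  have "0 < (\<Sum>x\<in>{undefined}. exp (log_birkhoff_sum T f n x))" by simp
  also have "\<dots> \<le> separated_sum_sup T f n \<epsilon>"
    using assms by (intro separated_sum_le_sup) (auto simp: bowen_separated_def)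
  finally show ?thesis .
qed

lemma ln_separated_sum_sup_mono:
  assumes f: "continuous_on UNIV f" and g: "continuous_on UNIV g" and n: "n \<ge> 1" and e: "\<epsilon> > 0"
    and le: "\<And>x. log_birkhoff_sum T f n x \<le> log_birkhoff_sum T g n x + c"
  shows "ln (separated_sum_sup T f n \<epsilon>) \<le> ln (separated_sum_sup T g n \<epsilon>) + c"
proof -
  have "separated_sum_sup T f n \<epsilon> \<le> exp c * separated_sum_sup T g n \<epsilon>"
  proof (rule separated_sum_sup_le)
    fix E assume E: "bowen_separated T n \<epsilon> E"
    have "(\<Sum>x\<in>E. exp (log_birkhoff_sum T f n x)) \<le> (\<Sum>x\<in>E. exp c * exp (log_birkhoff_sum T g n x))"
      using le by (intro sum_mono) (simp add: exp_add[symmetric] add.commute)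
    also have "\<dots> \<le> exp c * separated_sum_sup T g n \<epsilon>"
      using separated_sum_le_sup[OF g n e E] by (simp add: sum_distrib_left[symmetric])
    finally show "(\<Sum>x\<in>E. exp (log_birkhoff_sum T f n x)) \<le> exp c * separated_sum_sup T g n \<epsilon>" .
  qed
  then have "ln (separated_sum_sup T f n \<epsilon>) \<le> ln (exp c * separated_sum_sup T g n \<epsilon>)"
    using separated_sum_sup_pos[OF f n e] by (intro ln_mono) auto
  also have "\<dots> = ln (separated_sum_sup T g n \<epsilon>) + c"
    using separated_sum_sup_pos[OF g n e] by (simp add: ln_mult)
  finally show ?thesis .
qed

text \<open>Hoelder's inequality with weights \<open>s\<close> and \<open>1 - s\<close>: after
  division by \<open>exp A\<close> and \<open>exp B\<close> the two sums are at most
  \<open>1\<close>, and convexity of \<open>exp\<close> is applied to each summand. This also covers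
  \<open>s = 0\<close> and \<open>s = 1\<close>.\<close>

lemma ln_separated_sum_sup_convex:
  assumes f: "continuous_on UNIV f" and g: "continuous_on UNIV g" and n: "n \<ge> 1" and e: "\<epsilon> > 0"
    and s: "0 \<le> s" "s \<le> 1"
  shows "ln (separated_sum_sup T (\<lambda>x. s * f x + (1 - s) * g x) n \<epsilon>)
    \<le> s * ln (separated_sum_sup T f n \<epsilon>) + (1 - s) * ln (separated_sum_sup T g n \<epsilon>)"
proof -
  define A where "A = ln (separated_sum_sup T f n \<epsilon>)"
  define B where "B = ln (separated_sum_sup T g n \<epsilon>)"
  let ?h = "\<lambda>x. s * f x + (1 - s) * g x"
  let ?a = "log_birkhoff_sum T f n" and ?b = "log_birkhoff_sum T g n"
  have h: "continuous_on UNIV ?h" using f g by (intro continuous_intros)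
  have eA: "exp A = separated_sum_sup T f n \<epsilon>" and eB: "exp B = separated_sum_sup T g n \<epsilon>"
    using separated_sum_sup_pos[OF f n e] separated_sum_sup_pos[OF g n e] by (simp_all add: A_def B_def)
  have S: "log_birkhoff_sum T ?h n x = s * ?a x + (1 - s) * ?b x" for x
    by (simp add: log_birkhoff_sum_def sum.distrib sum_distrib_left)
  have "separated_sum_sup T ?h n \<epsilon> \<le> exp (s * A + (1 - s) * B)"
  proof (rule separated_sum_sup_le)
    fix E assume E: "bowen_separated T n \<epsilon> E"
    have "exp (log_birkhoff_sum T ?h n x) \<le>
        exp (s * A + (1 - s) * B) * (s * (exp (?a x) / exp A) + (1 - s) * (exp (?b x) / exp B))" for x
    proof -
      have "exp (log_birkhoff_sum T ?h n x) =
          exp (s * A + (1 - s) * B) * exp (s * (?a x - A) + (1 - s) * (?b x - B))"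
        unfolding S exp_add[symmetric] by (simp add: algebra_simps)
      also have "exp (s * (?a x - A) + (1 - s) * (?b x - B)) \<le> s * exp (?a x - A) + (1 - s) * exp (?b x - B)"
        using convex_onD[OF exp_convex, of "1 - s" "?a x - A" "?b x - B"] s by simp
      finally show ?thesis by (simp add: exp_diff)
    qed
    then have "(\<Sum>x\<in>E. exp (log_birkhoff_sum T ?h n x)) \<le> (\<Sum>x\<in>E. 
        exp (s * A + (1 - s) * B) * (s * (exp (?a x) / exp A) + (1 - s) * (exp (?b x) / exp B)))"
      by (intro sum_mono)
    also have "\<dots> = exp (s * A + (1 - s) * B) *
        (s * ((\<Sum>x\<in>E. exp (?a x)) / exp A) + (1 - s) * ((\<Sum>x\<in>E. exp (?b x)) / exp B))"
      by (simp only: sum_distrib_left[symmetric] sum.distrib sum_divide_distrib[symmetric])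
    also have "\<dots> \<le> exp (s * A + (1 - s) * B) * (s * 1 + (1 - s) * 1)"
      using separated_sum_le_sup[OF f n e E] separated_sum_le_sup[OF g n e E] s
      unfolding eA[symmetric] eB[symmetric] by (intro mult_left_mono add_mono) auto
    finally show "(\<Sum>x\<in>E. exp (log_birkhoff_sum T ?h n x)) \<le> exp (s * A + (1 - s) * B)" by simp
  qed
  then have "ln (separated_sum_sup T ?h n \<epsilon>) \<le> ln (exp (s * A + (1 - s) * B))"
    using separated_sum_sup_pos[OF h n e] by (intro ln_mono) auto
  then show ?thesis by (simp add: A_def B_def)
qed

text \<open>The error \<open>c n\<close> may depend on \<open>n\<close>, because two cases are
  wanted: shifting a function by a constant costs a multiple of about \<open>ln n\<close>, whereas a
  coboundary costs a bounded amount.\<close>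

lemma pol_pressure_at_mono:
  assumes f: "continuous_on UNIV f" and g: "continuous_on UNIV g" and e: "\<epsilon> > 0"
    and le: "\<And>n x. n \<ge> 2 \<Longrightarrow> log_birkhoff_sum T f n x \<le> log_birkhoff_sum T g n x + c n"
    and lim: "(\<lambda>n. c n / ln (real n)) \<longlonglongrightarrow> C"
  shows "pol_pressure_at T f \<epsilon> \<le> ereal C + pol_pressure_at T g \<epsilon>"
proof -
  have "pol_pressure_at T f \<epsilon> \<le>
      limsup (\<lambda>n. ereal (c n / ln (real n)) + ereal (1 / ln (real n) * ln (separated_sum_sup T g n \<epsilon>)))"
    unfolding pol_pressure_at_def
  \<comment> \<open>From \<open>n = 2\<close> on, \<open>ln n\<close> is positive and the inequality
    survives the division.\<close>
  proof (rule Limsup_mono, rule eventually_sequentiallyI[of 2])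
    fix n :: nat assume n: "2 \<le> n"
    have "ln (separated_sum_sup T f n \<epsilon>) \<le> ln (separated_sum_sup T g n \<epsilon>) + c n"
      using n by (intro ln_separated_sum_sup_mono f g e le) auto
    then show "ereal (1 / ln (real n) * ln (separated_sum_sup T f n \<epsilon>))
        \<le> ereal (c n / ln (real n)) + ereal (1 / ln (real n) * ln (separated_sum_sup T g n \<epsilon>))"
      using n by (simp add: field_simps)
  qed
  also have "\<dots> = ereal C + pol_pressure_at T g \<epsilon>"
    unfolding pol_pressure_at_def using lim by (intro ereal_limsup_lim_add) auto
  finally show ?thesis .
qed

lemma pol_pressure_mono:
  assumes f: "continuous_on UNIV f" and g: "continuous_on UNIV g"
    and le: "\<And>n x. n \<ge> 2 \<Longrightarrow> log_birkhoff_sum T f n x \<le> log_birkhoff_sum T g n x + c n"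
    and lim: "(\<lambda>n. c n / ln (real n)) \<longlonglongrightarrow> C"
  shows "pol_pressure T f \<le> ereal C + pol_pressure T g"
proof (rule tendsto_le)
  show "(pol_pressure_at T f \<longlongrightarrow> pol_pressure T f) (at_right 0)"
    by (rule pol_pressure_tendsto[OF X T f])
  show "((\<lambda>\<epsilon>. ereal C + pol_pressure_at T g \<epsilon>) \<longlongrightarrow> ereal C + pol_pressure T g) (at_right 0)"
    by (intro tendsto_add_ereal_general pol_pressure_tendsto[OF X T g] tendsto_const) auto
  show "eventually (\<lambda>\<epsilon>. pol_pressure_at T f \<epsilon> \<le> ereal C + pol_pressure_at T g \<epsilon>) (at_right 0)"
    using eventually_at_right_less by eventually_elim (rule pol_pressure_at_mono[OF f g _ le lim])
qed simp

text \<open>The sum \<open>S\<^sub>n\<close> has \<open>\<lfloor>ln n\<rfloor> + 2\<close> summands,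
  so a shift by \<open>c\<close> contributes \<open>c\<close> that many times; division by
  \<open>ln n\<close> leaves \<open>c\<close> in the limit.\<close>

lemma pol_pressure_le:
  assumes f: "continuous_on UNIV f" and g: "continuous_on UNIV g" and le: "\<And>x. f x \<le> g x + c"
  shows "pol_pressure T f \<le> ereal c + pol_pressure T g"
proof (rule pol_pressure_mono[OF f g])
  fix n :: nat and x :: 'a
  have "log_birkhoff_sum T f n x \<le> (\<Sum>j = 0..nat (\<lfloor>ln (real n)\<rfloor> + 1). g ((T ^^ j) x) + c)"
    unfolding log_birkhoff_sum_def by (intro sum_mono le)
  then show "log_birkhoff_sum T f n x \<le>
      log_birkhoff_sum T g n x + real (Suc (nat (\<lfloor>ln (real n)\<rfloor> + 1))) * c"
    by (simp add: log_birkhoff_sum_def sum.distrib)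
next
  have "(\<lambda>n. (of_int \<lfloor>ln (real n)\<rfloor> + 2) / ln (real n)) \<longlonglongrightarrow> 1"
    by real_asymp
  from tendsto_mult_right[OF this, of c]
  have "(\<lambda>n. (of_int \<lfloor>ln (real n)\<rfloor> + 2) * c / ln (real n)) \<longlonglongrightarrow> c" by simp
  \<comment> \<open>For \<open>n \<ge> 1\<close> the floor is nonnegative, so \<open>nat\<close>
    does not truncate.\<close>
  moreover have "eventually (\<lambda>n. (of_int \<lfloor>ln (real n)\<rfloor> + 2) * c / ln (real n) =
      real (Suc (nat (\<lfloor>ln (real n)\<rfloor> + 1))) * c / ln (real n)) sequentially"
    by (rule eventually_sequentiallyI[of 1]) simp
  ultimately show "(\<lambda>n. real (Suc (nat (\<lfloor>ln (real n)\<rfloor> + 1))) * c / ln (real n)) \<longlonglongrightarrow> c"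
    by (rule Lim_transform_eventually)
qed

text \<open>The sums telescope to a difference of two values of \<open>f\<close>, which is bounded
  uniformly in \<open>n\<close> and disappears after division by \<open>ln n\<close>. Both signs are
  recorded in order to get an equality of integrals from the subgradient inequality.\<close>

lemma pol_pressure_coboundary:
  assumes f: "continuous_on UNIV f"
  shows "pol_pressure T (\<lambda>x. f (T x) - f x) \<le> pol_pressure T (\<lambda>_. 0)"
    and "pol_pressure T (\<lambda>x. f x - f (T x)) \<le> pol_pressure T (\<lambda>_. 0)"
proof -
  have "bounded (range f)"
    by (intro compact_imp_bounded compact_continuous_image f X)
  then obtain B where B: "\<And>x. \<bar>f x\<bar> \<le> B" by (auto simp: bounded_iff)
  have fT: "continuous_on UNIV (\<lambda>x. f (T x))"
    by (rule continuous_on_compose2[OF f T]) auto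
  have tele: "(\<Sum>j = 0..m. f (T ((T ^^ j) x)) - f ((T ^^ j) x)) = f ((T ^^ Suc m) x) - f x" for m x
    by (induction m) auto
  have tele': "(\<Sum>j = 0..m. f ((T ^^ j) x) - f (T ((T ^^ j) x))) = f x - f ((T ^^ Suc m) x)" for m x
    by (induction m) auto
  have lim: "(\<lambda>n. 2 * B / ln (real n)) \<longlonglongrightarrow> 0" by real_asymp
  have "log_birkhoff_sum T (\<lambda>x. f (T x) - f x) n x \<le> log_birkhoff_sum T (\<lambda>_. 0) n x + 2 * B" for n x
    using B[of x] B[of "(T ^^ Suc (nat (\<lfloor>ln (real n)\<rfloor> + 1))) x"]
    unfolding log_birkhoff_sum_def tele by simp
  from pol_pressure_mono[OF _ _ this lim]
  show "pol_pressure T (\<lambda>x. f (T x) - f x) \<le> pol_pressure T (\<lambda>_. 0)"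
    using f fT by (simp add: continuous_intros zero_ereal_def[symmetric])
  have "log_birkhoff_sum T (\<lambda>x. f x - f (T x)) n x \<le> log_birkhoff_sum T (\<lambda>_. 0) n x + 2 * B" for n x
    using B[of x] B[of "(T ^^ Suc (nat (\<lfloor>ln (real n)\<rfloor> + 1))) x"]
    unfolding log_birkhoff_sum_def tele' by simp
  from pol_pressure_mono[OF _ _ this lim]
  show "pol_pressure T (\<lambda>x. f x - f (T x)) \<le> pol_pressure T (\<lambda>_. 0)"
    using f fT by (simp add: continuous_intros zero_ereal_def[symmetric])
qed

text \<open>One-point separated sets show that the pressure of \<open>0\<close> is nonnegative, so
  it is finite; comparing \<open>f\<close> with \<open>0\<close> up to the constant \<open>B\<close>
  in both directions transfers this to \<open>f\<close>.\<close>

lemma pol_pressure_finite: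
  assumes fin: "pol_pressure T (\<lambda>_. 0) < \<infinity>" and f: "continuous_on UNIV f"
  shows "\<bar>pol_pressure T f\<bar> \<noteq> \<infinity>"
proof -
  have "bounded (range f)"
    by (intro compact_imp_bounded compact_continuous_image f X)
  then obtain B where B: "\<And>x. \<bar>f x\<bar> \<le> B" by (auto simp: bounded_iff)
  have "0 \<le> pol_pressure_at T (\<lambda>_. 0) \<epsilon>" if "\<epsilon> > 0" for \<epsilon>
    unfolding pol_pressure_at_def
  proof (rule le_Limsup)
    show "eventually (\<lambda>n. 0 \<le> ereal (1 / ln (real n) * ln (separated_sum_sup T (\<lambda>_. 0) n \<epsilon>))) sequentially"
    proof (rule eventually_sequentiallyI[of 2])
      fix n :: nat assume n: "2 \<le> n"
      have "1 \<le> separated_sum_sup T (\<lambda>_. 0) n \<epsilon>"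
        using separated_sum_le_sup[of "\<lambda>_. 0" n \<epsilon> "{undefined}"] n that
        by (simp add: bowen_separated_def log_birkhoff_sum_def)
      then show "0 \<le> ereal (1 / ln (real n) * ln (separated_sum_sup T (\<lambda>_. 0) n \<epsilon>))"
        using n by simp
    qed
  qed simp
  then have nonneg: "0 \<le> pol_pressure T (\<lambda>_. 0)"
    by (intro tendsto_lowerbound[OF pol_pressure_tendsto[OF X T]] eventually_at_rightI[of 0 1]) auto
  have "pol_pressure T f \<le> ereal B + pol_pressure T (\<lambda>_. 0)"
    using B by (intro pol_pressure_le f) (auto simp: abs_le_iff)
  moreover have "0 \<le> f x + B" for x using B[of x] by simp
  then have "pol_pressure T (\<lambda>_. 0) \<le> ereal B + pol_pressure T f"
    by (intro pol_pressure_le f) auto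
  ultimately show ?thesis
    using fin nonneg by (cases "pol_pressure T f"; cases "pol_pressure T (\<lambda>_. 0)") auto
qed

text \<open>Hoelder's inequality passes through the subadditive \<open>limsup\<close> and then
  through the limit in \<epsilon>. Finiteness of both pressures excludes
  \<open>\<infinity> - \<infinity>\<close> in the limit of the sum.\<close>

lemma pol_pressure_convex:
  assumes fin: "pol_pressure T (\<lambda>_. 0) < \<infinity>"
    and f: "continuous_on UNIV f" and g: "continuous_on UNIV g" and s: "0 \<le> s" "s \<le> 1"
  shows "pol_pressure T (\<lambda>x. s * f x + (1 - s) * g x)
    \<le> ereal s * pol_pressure T f + ereal (1 - s) * pol_pressure T g"
proof (rule tendsto_le)
  let ?h = "\<lambda>x. s * f x + (1 - s) * g x"
  have h: "continuous_on UNIV ?h" using f g by (intro continuous_intros)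
  show "(pol_pressure_at T ?h \<longlongrightarrow> pol_pressure T ?h) (at_right 0)"
    by (rule pol_pressure_tendsto[OF X T h])
  show "((\<lambda>\<epsilon>. ereal s * pol_pressure_at T f \<epsilon> + ereal (1 - s) * pol_pressure_at T g \<epsilon>)
      \<longlongrightarrow> ereal s * pol_pressure T f + ereal (1 - s) * pol_pressure T g) (at_right 0)"
    using pol_pressure_finite[OF fin f] pol_pressure_finite[OF fin g]
    by (intro tendsto_add_ereal tendsto_cmult_ereal pol_pressure_tendsto X T f g) auto
  have "pol_pressure_at T ?h \<epsilon> \<le> ereal s * pol_pressure_at T f \<epsilon> + ereal (1 - s) * pol_pressure_at T g \<epsilon>"
    if e: "\<epsilon> > 0" for \<epsilon>
  proof -
    have "pol_pressure_at T ?h \<epsilon> \<le> limsup (\<lambda>n.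
        ereal s * ereal (1 / ln (real n) * ln (separated_sum_sup T f n \<epsilon>)) +
        ereal (1 - s) * ereal (1 / ln (real n) * ln (separated_sum_sup T g n \<epsilon>)))"
      unfolding pol_pressure_at_def
    proof (rule Limsup_mono, rule eventually_sequentiallyI[of 2])
      fix n :: nat assume n: "2 \<le> n"
      have "ln (separated_sum_sup T ?h n \<epsilon>)
          \<le> s * ln (separated_sum_sup T f n \<epsilon>) + (1 - s) * ln (separated_sum_sup T g n \<epsilon>)"
        using n by (intro ln_separated_sum_sup_convex f g e s) auto
      then have "1 / ln (real n) * ln (separated_sum_sup T ?h n \<epsilon>)
          \<le> 1 / ln (real n) * (s * ln (separated_sum_sup T f n \<epsilon>) + (1 - s) * ln (separated_sum_sup T g n \<epsilon>))"
        using n by (intro mult_left_mono) auto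
      then show "ereal (1 / ln (real n) * ln (separated_sum_sup T ?h n \<epsilon>)) \<le>
        ereal s * ereal (1 / ln (real n) * ln (separated_sum_sup T f n \<epsilon>)) +
        ereal (1 - s) * ereal (1 / ln (real n) * ln (separated_sum_sup T g n \<epsilon>))"
        by (simp add: distrib_left mult.left_commute)
    qed
    also have "\<dots> \<le> ereal s * pol_pressure_at T f \<epsilon> + ereal (1 - s) * pol_pressure_at T g \<epsilon>"
      unfolding pol_pressure_at_def using s
      by (intro order_trans[OF ereal_limsup_add_mono]) (simp add: limsup_ereal_mult_left del: times_ereal.simps)
    finally show ?thesis .
  qed
  then show "eventually (\<lambda>\<epsilon>. pol_pressure_at T ?h \<epsilon> \<le>
      ereal s * pol_pressure_at T f \<epsilon> + ereal (1 - s) * pol_pressure_at T g \<epsilon>) (at_right 0)"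
    using eventually_at_right_less[of "0::real"] by (auto elim!: eventually_mono)
qed simp

end

section \<open>The variational principle for polynomial entropy\<close>

theorem theoremA:
  fixes T :: "'a::metric_space \<Rightarrow> 'a"
  assumes "compact (UNIV :: 'a set)"
    and "continuous_on UNIV T"
    and "pol_top_entropy T < \<infinity>"
  shows "pol_top_entropy T \<in> pol_measure_entropy T ` invariant_measures T \<and>
    (\<forall>\<mu>\<in>invariant_measures T. pol_measure_entropy T \<mu> \<le> pol_top_entropy T)"
proof -
  note X = assms(1) and T = assms(2)
  note fin = assms(3)[unfolded pol_top_entropy_def]
  \<comment> \<open>The subgradient theorem wants a real-valued functional; by finiteness nothing is
    lost on continuous functions.\<close>
  define Q where "Q f = real_of_ereal (pol_pressure T f)" for f
  have PQ: "pol_pressure T f = ereal (Q f)" if "continuous_on UNIV f" for f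
    using pol_pressure_finite[OF X T fin that] by (simp add: Q_def ereal_real)
  obtain \<mu> :: "'a measure" where \<mu>: "prob_space \<mu>" "sets \<mu> = sets borel"
    and sub: "\<And>f. continuous_on UNIV f \<Longrightarrow> Q (\<lambda>_. 0) + (\<integral>x. f x \<partial>\<mu>) \<le> Q f"
  proof (rule convex_functional_subgradient_measure[OF X, of Q])
    fix f g :: "'a \<Rightarrow> real" and s :: real
    assume *: "continuous_on UNIV f" "continuous_on UNIV g" "0 \<le> s" "s \<le> 1"
    have "continuous_on UNIV (\<lambda>x. s * f x + (1 - s) * g x)" using * by (intro continuous_intros)
    then show "Q (\<lambda>x. s * f x + (1 - s) * g x) \<le> s * Q f + (1 - s) * Q g"
      using pol_pressure_convex[OF X T fin *] * by (simp add: PQ)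
  next
    fix f g :: "'a \<Rightarrow> real" and c :: real
    assume *: "continuous_on UNIV f" "continuous_on UNIV g" "\<And>x. f x \<le> g x + c"
    show "Q f \<le> Q g + c" using pol_pressure_le[OF X T *] * by (simp add: PQ)
  qed (rule that)
  interpret prob_space \<mu> by fact
  \<comment> \<open>The function \<open>0\<close> competes in the infimum that defines the measure
    entropy.\<close>
  have upper: "pol_measure_entropy T \<nu> \<le> pol_top_entropy T" for \<nu>
  proof -
    have "pol_measure_entropy T \<nu> \<le> pol_pressure T (\<lambda>_. 0) - ereal (\<integral>x. 0 \<partial>\<nu>)"
      unfolding pol_measure_entropy_def by (rule INF_lower) simp
    then show ?thesis by (simp add: pol_top_entropy_def zero_ereal_def[symmetric])
  qed
  have lower: "pol_top_entropy T \<le> pol_measure_entropy T \<mu>"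
    unfolding pol_measure_entropy_def pol_top_entropy_def
    using sub by (intro INF_greatest) (simp add: PQ le_diff_eq)
  have T_meas: "T \<in> measurable \<mu> borel"
    using borel_measurable_continuous_onI[OF T] \<mu>(2) measurable_cong_sets by blast
  have "distr \<mu> borel T = \<mu>"
  proof (rule borel_measure_eqI_continuous)
    show "finite_measure (distr \<mu> borel T)"
      using T_meas by (intro finite_measure_distr)
    fix f :: "'a \<Rightarrow> real" assume f: "continuous_on UNIV f" and bnd: "\<And>x. 0 \<le> f x \<and> f x \<le> 1"
    have fT: "continuous_on UNIV (\<lambda>x. f (T x))" by (rule continuous_on_compose2[OF f T]) auto
    have int: "integrable \<mu> g" if "continuous_on UNIV g" "\<And>x. 0 \<le> g x \<and> g x \<le> 1" for g :: "'a \<Rightarrow> real"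
    proof (rule integrable_const_bound[where B = 1])
      show "g \<in> borel_measurable \<mu>"
        using borel_measurable_continuous_onI[OF that(1)] \<mu>(2) measurable_cong_sets by blast
    qed (use that(2) in simp)
    have ints: "integrable \<mu> f" "integrable \<mu> (\<lambda>x. f (T x))" using f fT bnd by (auto intro: int)
    have conts: "continuous_on UNIV (\<lambda>x. f (T x) - f x)" "continuous_on UNIV (\<lambda>x. f x - f (T x))"
      using f fT by (auto intro: continuous_on_diff)
    \<comment> \<open>The subgradient inequality at \<open>f \<circ> T - f\<close> and at its
      negative makes both integrals at most \<open>0\<close>, so the integrals of
      \<open>f \<circ> T\<close> and \<open>f\<close> agree.\<close>
    have "Q (\<lambda>x. f (T x) - f x) \<le> Q (\<lambda>_. 0)" "Q (\<lambda>x. f x - f (T x)) \<le> Q (\<lambda>_. 0)"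
      using pol_pressure_coboundary[OF X T f] conts by (simp_all add: PQ)
    then have "(\<integral>x. f (T x) \<partial>\<mu>) = (\<integral>x. f x \<partial>\<mu>)"
      using sub[OF conts(1)] sub[OF conts(2)] ints by simp
    then show "(\<integral>x. f x \<partial>distr \<mu> borel T) = (\<integral>x. f x \<partial>\<mu>)"
      using T_meas borel_measurable_continuous_onI[OF f] by (subst integral_distr) auto
  qed (use \<mu> in \<open>auto intro: finite_measure_axioms\<close>)
  then have "\<mu> \<in> invariant_measures T" using \<mu> by (simp add: invariant_measures_def)
  then show ?thesis using upper lower antisym by blast
qed

end
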